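(* Let $p,q,n$ be positive integers with $p+q$ odd, and let $a,b\in\{1,-1\}$, with $p\neq 1$ when $b=1$, and $q\neq 1$ when $a=1$. For a positive integer $N$ put $\mathcal{H}_{N}^{(p)}(b)=\sum_{m=1}^{N}\frac{b^{m-1}}{m^p}$. Then $$\begin{aligned}\sum_{k=1}^\infty\frac{a^k\,\mathcal{H}_{nk}^{(p)}(b)}{k^q}={}&\tfrac12 ab^{n-1}n^{-p}\,\Phi(ab^n,p+q,1)+\tfrac12a(1-(-1)^{p})\,\Phi(a,q,1)\,\Phi(b,p,1)\\ &-ab^n(-n)^{q}\sum_{k=0}^{\lfloor q/2\rfloor}\binom{p+q-2k-1}{p-1}n^{-2k}\,\Phi(ab^n,2k,1)\,\Phi(b,p+q-2k,1)\\ &+b^{n-1}(-n)^{-p}\sum_{j=0}^{\lfloor p/2\rfloor}\binom{p+q-2j-1}{q-1}\Phi(ab^n,2j,1)\,\Phi(a,p+q-2j,1)\\ &+\tfrac{a}{2}(-n)^{-p}\sum_{j=2}^{n}\sum_{k=1}^{p}\binom{p+q-k-1}{q-1}b^{j}(-1)^{k}\,\Theta(ab^n,k,j-1,n)\,\Phi\!\left(a,p+q-k,\tfrac{n-j+1}{n}\right).\end{aligned}$$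
   Context: Lerch function: for $c=\pm1$, integer $q\ge1$ (with $q\neq1$ if $c=1$) and $\alpha>0$, $\Phi(c,q,\alpha)=\sum_{m=0}^\infty \frac{c^m}{(m+\alpha)^q}$. At $q=0$, $\alpha=1$ the values by analytic continuation are used: $\Phi(1,0,1)=\zeta(0)=-\tfrac12$ and $\Phi(-1,0,1)=\eta(0)=\tfrac12$. For $c=\pm1$, integer $k\ge 1$ and $0<s<r$: $\Theta(c,k,s,r)=\Phi(c,k,\tfrac{s}{r})+c(-1)^{k}\Phi(c,k,\tfrac{r-s}{r})$ if $(c,k)\ne(1,1)$, and $\Theta(1,1,s,r)=\pi\cot(\pi s/r)$. Empty sums are $0$. *)

theory Defs
  imports "HOL-Analysis.Analysis"
begin

(* The series is used for c = 1 or c = -1, q > 0, alpha > 0 and (c, q) \<noteq> (1, 1); for (c, q) = (-1, 1)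
   it converges only conditionally, in which case suminf is still the limit of the partial sums.
   For q = 0, alpha = 1 the series diverges and the values come from analytic continuation:
   zeta(0) = -1/2 for c = 1 and eta(0) = 1/2 for c = -1. Other arguments are not meaningful. *)
definition lerch_phi :: "real \<Rightarrow> nat \<Rightarrow> real \<Rightarrow> real" where
  "lerch_phi c q \<alpha> =
     (if q = 0 \<and> \<alpha> = 1 then (if c = 1 then - 1 / 2 else 1 / 2)
      else (\<Sum>m. c ^ m / (real m + \<alpha>) ^ q))"

(* Meaningful for k > 0 and 0 < s < r. At (c, k) = (1, 1) the two series diverge individually;
   pi * cot (pi * s / r) is the value of the series of their differences. *)
definition lerch_theta :: "real \<Rightarrow> nat \<Rightarrow> real \<Rightarrow> real \<Rightarrow> real" where
  "lerch_theta c k s r =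
     (if c = 1 \<and> k = 1 then pi * cot (pi * s / r)
      else lerch_phi c k (s / r) + c * (- 1) ^ k * lerch_phi c k ((r - s) / r))"

definition gen_harmonic :: "nat \<Rightarrow> nat \<Rightarrow> real \<Rightarrow> real" where
  "gen_harmonic p N b = (\<Sum>m=1..N. b ^ (m - 1) / real m ^ p)"

end

theory Submission
  imports Defs "HOL-Real_Asymp.Real_Asymp"
begin

text \<open>
  Put \<open>c = a * b ^ n\<close> and sum \<open>c ^ k * b ^ m / ((n * k) ^ q * (n * k - m) ^ p)\<close> over all integers \<open>k\<close>
  and all \<open>m \<ge> 1\<close>, leaving out the poles \<open>k = 0\<close> and \<open>m = n * k\<close>. Summing over \<open>m\<close> first, with
  \<open>y = n * k - m\<close>, gives partial sums of \<open>b ^ y / y ^ p\<close>; since \<open>p + q\<close> is odd, the contributions of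
  \<open>k\<close> and \<open>- k\<close> add up to twice the harmonic sum, minus lower terms. Summing over \<open>k\<close> first, a partial
  fraction expansion in \<open>n * k\<close> leaves only the one-dimensional lattice sums of \<open>c ^ k / (n * k - m) ^ i\<close>,
  which depend on \<open>m\<close> modulo \<open>n\<close> up to a power of \<open>c\<close> and are the zeta and \<open>lerch_theta\<close> values of the
  right-hand side. The two orders agree because the truncations to \<open>\<bar>k\<bar> \<le> K\<close> are Cauchy
  uniformly in the cut-off for \<open>m\<close>.
\<close>

subsection \<open>Partial fractions and one-dimensional series\<close>

text \<open>The obstacle is conditional convergence. For \<open>p = 1\<close> or
  \<open>q = 1\<close> the double series is not absolutely convergent, and partial fractions always
  create the lattice sum with \<open>i = 1\<close>, which for \<open>c = 1\<close> exists only as a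
  limit over symmetric windows. Hence every sum over \<open>k\<close> is truncated symmetrically and
  the exchange of limits is proved by hand.

  Odd \<open>p + q\<close> enters twice. It gives \<open>(- 1) ^ q = - ((- 1) ^ p)\<close>, so that
  the halves \<open>k > 0\<close> and \<open>k < 0\<close> reinforce each other, and it excludes
  \<open>p = q = 1\<close>, so that one of the exponents is at least 2.

  The twist \<open>c = a * b ^ n\<close> makes \<open>c ^ k * b ^ m\<close> equal to
  \<open>a ^ k * b ^ (n * k - m)\<close>: in terms of \<open>y\<close> the sign of the inner sum is
  \<open>b\<close>, and along a residue class of \<open>m\<close> modulo \<open>n\<close> the sign
  that survives is \<open>a\<close>.

  The values of the Lerch function at exponent 0 do not come from analytic continuation here.
  Leaving out the poles spoils the partial fractions there, and the resulting corrections of total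
  weight \<open>p + q\<close> have the coefficients of an index-0 term in which
  \<open>- c / 2\<close> stands for the Lerch value.\<close>

lemma partial_fraction_expansion:
  fixes X D w :: real
  assumes XD: "X * D = w * (D - X)"
  shows "X ^ Suc q * D ^ Suc p =
      (- 1) ^ Suc p * (\<Sum>l\<le>q. real ((p + l) choose p) * w ^ (p + l + 1) * X ^ (Suc q - l))
      + (\<Sum>l\<le>p. (- 1) ^ l * real ((q + l) choose q) * w ^ (q + l + 1) * D ^ (Suc p - l))"
proof -
  \<comment> \<open>With \<open>X = 1 / x\<close>, \<open>D = 1 / (x - y)\<close>,
    \<open>w = 1 / y\<close> these are, up to sign, the principal parts at \<open>x = 0\<close> and
    \<open>x = y\<close>. Phrased as a polynomial identity modulo the relation \<open>XD\<close>,
    the expansion needs no division.\<close>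
  define A where "A p q = (\<Sum>l\<le>q. real ((p + l) choose p) * w ^ (p + l + 1) * X ^ (Suc q - l))"
    for p q
  define B where "B p q = (\<Sum>l\<le>p. (- 1) ^ l * real ((q + l) choose q) * w ^ (q + l + 1) * D ^ (Suc p - l))"
    for p q
  have pascal: "(\<Sum>l\<le>Suc r. z ^ l * real ((Suc s + l) choose Suc s) * w ^ (Suc s + l + 1) * Y ^ (Suc (Suc r) - l)) =
      w * ((\<Sum>l\<le>Suc r. z ^ l * real ((s + l) choose s) * w ^ (s + l + 1) * Y ^ (Suc (Suc r) - l))
         + z * (\<Sum>l\<le>r. z ^ l * real ((Suc s + l) choose Suc s) * w ^ (Suc s + l + 1) * Y ^ (Suc r - l)))"
    for r s and z Y :: real
    by (simp add: sum.atMost_Suc_shift sum_distrib_left sum.distrib [symmetric] algebra_simps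
        del: sum.atMost_Suc)
  have A_rec: "A (Suc p) (Suc q) = w * (A p (Suc q) + A (Suc p) q)" for p q
    using pascal [where z = 1 and s = p and r = q and Y = X] by (simp only: A_def power_one mult_1)
  have B_rec: "B (Suc p) (Suc q) = w * (B (Suc p) q - B p (Suc q))" for p q
    using pascal [where z = "- 1" and s = q and r = p and Y = D] by (simp only: B_def mult_minus1 diff_conv_add_uminus)
  have shift: "(\<Sum>l\<le>Suc r. u l * Y ^ (Suc (Suc r) - l)) = Y * (\<Sum>l\<le>r. u l * Y ^ (Suc r - l)) + u (Suc r) * Y"
    for r u and Y :: real
    by (simp add: sum_distrib_left Suc_diff_le algebra_simps)
  have "X ^ Suc q * D ^ Suc p = (- 1) ^ Suc p * A p q + B p q"
  proof (induction "p + q" arbitrary: p q rule: less_induct)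
    case less
    show ?case
    proof (cases p)
      case 0
      show ?thesis
      proof (cases q)
        case 0
        with \<open>p = 0\<close> XD show ?thesis by (simp add: A_def B_def algebra_simps)
      next
        case (Suc r)
        have "X ^ Suc q * D ^ Suc p = X * (X ^ Suc r * D ^ Suc 0)"
          using Suc \<open>p = 0\<close> by simp
        also have "\<dots> = X * (- A 0 r + B 0 r)"
          using less [of 0 r] Suc \<open>p = 0\<close> by simp
        also have "\<dots> = - (X * A 0 r) + w ^ Suc r * (X * D)" by (simp add: B_def algebra_simps)
        also have "\<dots> = - (X * A 0 r + w ^ Suc (Suc r) * X) + w ^ Suc (Suc r) * D" 
          by (simp only: XD) (simp add: algebra_simps)
        also have "X * A 0 r + w ^ Suc (Suc r) * X = A 0 (Suc r)"
          using shift [where u = "\<lambda>l. w ^ (l + 1)" and r = r and Y = X] by (simp add: A_def)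
        finally show ?thesis using Suc \<open>p = 0\<close> by (simp add: B_def)
      qed
    next
      case (Suc s)
      show ?thesis
      proof (cases q)
        case 0
        have "X ^ Suc q * D ^ Suc p = D * (X ^ Suc 0 * D ^ Suc s)"
          using Suc 0 by simp
        also have "\<dots> = D * ((- 1) ^ Suc s * A s 0 + B s 0)"
          using less [of s 0] Suc 0 by simp
        also have "\<dots> = D * B s 0 + (- 1) ^ Suc s * w ^ Suc s * (X * D)" by (simp add: A_def algebra_simps)
        also have "\<dots> = D * B s 0 + (- 1) ^ Suc s * w ^ Suc (Suc s) * D + (- 1) ^ Suc (Suc s) * (w ^ Suc (Suc s) * X)" 
          by (simp only: XD) (simp add: algebra_simps)
        also have "D * B s 0 + (- 1) ^ Suc s * w ^ Suc (Suc s) * D = B (Suc s) 0"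
          using shift [where u = "\<lambda>l. (- 1) ^ l * w ^ (l + 1)" and r = s and Y = D] by (simp add: B_def)
        finally show ?thesis using Suc 0 by (simp add: A_def)
      next
        \<comment> \<open>One use of \<open>XD\<close> lowers one of the two exponents in each
          resulting monomial. The coefficients then match by Pascal's rule, which is what
          \<open>A_rec\<close> and \<open>B_rec\<close> express.\<close>
        case q: (Suc r)
        have "X ^ Suc q * D ^ Suc p = X ^ Suc r * D ^ Suc s * (X * D)"
          using Suc q by simp
        also have "\<dots> = w * (X ^ Suc r * D ^ Suc (Suc s) - X ^ Suc (Suc r) * D ^ Suc s)"
          by (simp only: XD) (simp add: algebra_simps)
        also have "\<dots> = w * (((- 1) ^ Suc (Suc s) * A (Suc s) r + B (Suc s) r)
             - ((- 1) ^ Suc s * A s (Suc r) + B s (Suc r)))"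
          using less [of "Suc s" r] less [of s "Suc r"] Suc q by simp
        also have "\<dots> = (- 1) ^ Suc p * A p q + B p q"
          by (simp add: Suc q A_rec B_rec algebra_simps)
        finally show ?thesis .
      qed
    qed
  qed
  then show ?thesis by (simp add: A_def B_def)
qed

section \<open>Convergence of the Lerch series and the cotangent expansion\<close>

lemma summable_lerch:
  fixes c \<alpha> :: real
  assumes c: "c \<in> {1, -1}" and r: "r > 0" "c = 1 \<Longrightarrow> r \<noteq> 1" and \<alpha>: "\<alpha> > 0"
  shows "summable (\<lambda>m. c ^ m / (real m + \<alpha>) ^ r)"
proof (cases "c = 1")
  case True
  with r have r2: "r \<ge> 2" by simp
  have "summable (\<lambda>m. inverse (of_nat (Suc m) ^ r) :: real)"
    using inverse_power_summable [OF r2, where 'a = real] by (subst summable_Suc_iff)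
  then have "summable (\<lambda>m. (1 / min 1 \<alpha>) ^ r * inverse (of_nat (Suc m) ^ r))"
    by (rule summable_mult)
  then show ?thesis
  proof (rule summable_comparison_test' [where N = 0])
    fix m :: nat
    have "min 1 \<alpha> * real (Suc m) \<le> real m + \<alpha>"
      using \<alpha> by (cases "\<alpha> \<le> 1") (auto simp: min_def algebra_simps mult_left_le_one_le)
    then have "(min 1 \<alpha> * real (Suc m)) ^ r \<le> (real m + \<alpha>) ^ r"
      using \<alpha> by (intro power_mono) auto
    then have "inverse ((real m + \<alpha>) ^ r) \<le> inverse ((min 1 \<alpha> * real (Suc m)) ^ r)"
      using \<alpha> by (intro le_imp_inverse_le) auto
    then show "norm (c ^ m / (real m + \<alpha>) ^ r) \<le> (1 / min 1 \<alpha>) ^ r * inverse (of_nat (Suc m) ^ r)"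
      using \<alpha> True by (simp add: power_mult_distrib power_divide divide_simps)
  qed
next
  case False
  then have c: "c = - 1" using c by simp
  have "(\<lambda>m. inverse ((real m + \<alpha>) ^ r)) \<longlonglongrightarrow> 0"
    using r filterlim_tendsto_add_at_top [OF tendsto_const [of \<alpha>] filterlim_real_sequentially]
    by (intro tendsto_inverse_0_at_top filterlim_pow_at_top) (simp_all add: add.commute)
  moreover have "inverse ((real (Suc m) + \<alpha>) ^ r) \<le> inverse ((real m + \<alpha>) ^ r)" for m
    using \<alpha> by (intro le_imp_inverse_le power_mono) auto
  ultimately have "summable (\<lambda>m. (- 1) ^ m * inverse ((real m + \<alpha>) ^ r))"
    using \<alpha> by (intro summable_Leibniz'(1)) auto
  then show ?thesis by (simp add: c divide_inverse)
qed

lemma lerch_phi_sums: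
  fixes c \<alpha> :: real
  assumes "c \<in> {1, -1}" "r > 0" "c = 1 \<Longrightarrow> r \<noteq> 1" "\<alpha> > 0"
  shows "(\<lambda>m. c ^ m / (real m + \<alpha>) ^ r) sums lerch_phi c r \<alpha>"
  using summable_sums [OF summable_lerch [OF assms]] assms by (simp add: lerch_phi_def)

lemma polylog_tendsto:
  fixes c :: real
  assumes "c \<in> {1, -1}" "r > 0" "c = 1 \<Longrightarrow> r \<noteq> 1"
  shows "(\<lambda>K. \<Sum>k=1..K. c ^ k / real k ^ r) \<longlonglongrightarrow> c * lerch_phi c r 1"
proof -
  have "(\<lambda>m. c * (c ^ m / (real m + 1) ^ r)) sums (c * lerch_phi c r 1)"
    using assms by (intro sums_mult lerch_phi_sums) auto
  moreover have "(\<Sum>k=1..K. c ^ k / real k ^ r) = (\<Sum>m<K. c * (c ^ m / (real m + 1) ^ r))" for K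
    by (simp add: sum.atLeast1_atMost_eq add.commute)
  ultimately show ?thesis by (simp add: sums_def)
qed

text \<open>Logarithmic derivative of Euler's reflection formula. On the open unit interval both
  Gamma values and the sine are positive, so real logarithms may be taken.\<close>

lemma Digamma_reflection:
  fixes x :: real
  assumes "0 < x" "x < 1"
  shows "Digamma (1 - x) - Digamma x = pi * cot (pi * x)"
proof -
  have eq: "ln_Gamma y + ln_Gamma (1 - y) = ln pi - ln (sin (pi * y))" if "0 < y" "y < 1" for y :: real
  proof -
    have "sin (pi * y) > 0" using that by (intro sin_gt_zero) auto
    have "complex_of_real (Gamma y * Gamma (1 - y)) = of_real (pi / sin (pi * y))"
      using Gamma_reflection_complex [of "of_real y"]
      by (simp add: Gamma_complex_of_real [symmetric] sin_of_real [symmetric])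
    then have "Gamma y * Gamma (1 - y) = pi / sin (pi * y)"
      by (simp only: of_real_eq_iff)
    then have "ln (Gamma y * Gamma (1 - y)) = ln (pi / sin (pi * y))" by simp
    then show ?thesis using that \<open>sin (pi * y) > 0\<close>
      by (simp add: ln_mult_pos ln_div ln_Gamma_real_pos)
  qed
  have sin: "sin (pi * x) > 0" using assms by (intro sin_gt_zero) auto
  have "((\<lambda>y. ln_Gamma y + ln_Gamma (1 - y)) has_field_derivative (Digamma x - Digamma (1 - x))) (at x)"
    using assms by (auto intro!: derivative_eq_intros)
  moreover have "((\<lambda>y. ln_Gamma y + ln_Gamma (1 - y)) has_field_derivative (- (pi * cot (pi * x)))) (at x)"
  proof (rule has_field_derivative_transform_within_open)
    show "((\<lambda>y. ln pi - ln (sin (pi * y))) has_field_derivative (- (pi * cot (pi * x)))) (at x)"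
      using sin by (auto intro!: derivative_eq_intros simp: cot_def)
    show "open {0<..<1::real}" "x \<in> {0<..<1}" using assms by auto
  qed (use eq in auto)
  ultimately show ?thesis by (metis DERIV_unique minus_diff_eq minus_minus)
qed

text \<open>In the difference of the limit formulas for \<open>Digamma\<close> at
  \<open>1 - x\<close> and \<open>x\<close> the logarithms cancel. This supplies the value of
  \<open>lerch_theta\<close> at \<open>(c, k) = (1, 1)\<close>, where the two Lerch series diverge
  separately.\<close>

lemma cot_partial_fractions:
  fixes x :: real
  assumes "0 < x" "x < 1"
  shows "(\<lambda>k. 1 / (real k + x) - 1 / (real k + 1 - x)) sums (pi * cot (pi * x))"
proof -
  have "(\<lambda>m. (ln (real m) - (\<Sum>k<m. inverse ((1 - x) + real k))) - (ln (real m) - (\<Sum>k<m. inverse (x + real k))))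
      \<longlonglongrightarrow> Digamma (1 - x) - Digamma x"
    using Digamma_LIMSEQ [of "1 - x"] Digamma_LIMSEQ [of x] assms by (intro tendsto_diff) auto
  then show ?thesis
    using assms by (simp add: sums_def Digamma_reflection sum_subtractf divide_inverse algebra_simps)
qed

subsection \<open>Symmetric lattice sums\<close>

lemma sum_symmetric_int:
  fixes f :: "int \<Rightarrow> 'a::comm_monoid_add"
  shows "(\<Sum>k\<in>{- int K..int K}. f k) = f 0 + (\<Sum>k=1..K. f (int k) + f (- int k))"
proof (induction K)
  case (Suc K)
  have "{- int (Suc K)..int (Suc K)} = insert (int (Suc K)) (insert (- int (Suc K)) {- int K..int K})"
    by auto
  then have "(\<Sum>k\<in>{- int (Suc K)..int (Suc K)}. f k) =
      f (int (Suc K)) + (f (- int (Suc K)) + (\<Sum>k\<in>{- int K..int K}. f k))"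
    by simp
  also have "\<dots> = f 0 + (\<Sum>k=1..Suc K. f (int k) + f (- int k))"
    unfolding Suc by (simp add: ac_simps del: of_nat_Suc)
  finally show ?case .
qed simp

text \<open>A symmetric window is not translation invariant; moving it by one costs exactly the two
  edge terms, which disappear in the limit even when the full sum converges only
  conditionally.\<close>

lemma sum_symmetric_int_shift:
  fixes f :: "int \<Rightarrow> 'a::ab_group_add"
  shows "(\<Sum>k\<in>{- int K..int K}. f (k - 1)) = (\<Sum>k\<in>{- int K..int K}. f k) + f (- int K - 1) - f (int K)"
proof -
  have "(\<Sum>k=1..K. f (int k - 1) + f (- int k - 1)) =
      (\<Sum>k=1..K. f (int k) + f (- int k)) + f 0 + f (- int K - 1) - f (int K) - f (- 1)"
    by (induction K) (simp_all add: algebra_simps minus_diff_commute)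
  then show ?thesis by (simp add: sum_symmetric_int [of "\<lambda>k. f (k - 1)"] sum_symmetric_int [of f])
qed

lemma abs_power_int_sign:
  fixes c :: real
  assumes "c \<in> {1, -1}"
  shows "\<bar>c powi k\<bar> = 1"
  using assms by (auto simp: power_int_abs)

lemma power_int_sign_minus:
  fixes c :: real
  assumes "c \<in> {1, -1}"
  shows "c powi (- k) = c powi k"
  using assms by (auto simp: power_int_minus power_int_minus_left)

text \<open>Only the absolute value 1 of the sign matters, so the exponent may be any function of
  \<open>K\<close>; allowing \<open>x\<close> of either sign serves both ends of the window.\<close>

lemma lattice_sum_edge:
  fixes c x y :: real
  assumes "c \<in> {1, -1}" "i > 0" "x \<noteq> 0"
  shows "(\<lambda>K. c powi (k K) / (x * real K + y) ^ i) \<longlonglongrightarrow> 0"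
proof -
  have "(\<lambda>K. inverse (x * real K + y)) \<longlonglongrightarrow> 0"
    using assms by real_asymp
  from tendsto_null_power [OF tendsto_rabs_zero [OF this] \<open>i > 0\<close>]
  have "(\<lambda>K. \<bar>inverse (x * real K + y)\<bar> ^ i) \<longlonglongrightarrow> 0" .
  then have "(\<lambda>K. \<bar>c powi (k K) / (x * real K + y) ^ i\<bar>) \<longlonglongrightarrow> 0"
    by (simp add: abs_mult power_abs divide_inverse abs_power_int_sign [OF assms(1)] power_inverse)
  then show ?thesis by (rule tendsto_rabs_zero_cancel)
qed

text \<open>Since \<open>1 / 0 = 0\<close> and \<open>i > 0\<close>, a pole at \<open>n * k = m\<close> drops out by itself; the same device
  is used in the double sum below.\<close>
definition lattice_sum :: "real \<Rightarrow> nat \<Rightarrow> nat \<Rightarrow> nat \<Rightarrow> nat \<Rightarrow> real" where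
  "lattice_sum c n i m K = (\<Sum>k\<in>{- int K..int K}. c powi k / (real n * of_int k - real m) ^ i)"

text \<open>The substitution of \<open>k - 1\<close> for \<open>k\<close> turns \<open>m + n\<close>
  into \<open>m\<close> and releases one factor \<open>c\<close>, so limits are periodic in
  \<open>m\<close> up to powers of \<open>c\<close>.\<close>

lemma lattice_sum_add:
  assumes c: "c \<in> {1, -1}" and "n > 0" "i > 0"
  and lim: "lattice_sum c n i m \<longlonglongrightarrow> z"
  shows "lattice_sum c n i (m + n) \<longlonglongrightarrow> c * z"
proof -
  define e where "e k = c powi k / (real n * of_int k - real m) ^ i" for k :: int
  have "e (- int K - 1) = c powi (- int K - 1) / (- real n * real K + (- real n - real m)) ^ i" for K
  proof -
    have "real n * of_int (- int K - 1) - real m = - real n * real K + (- real n - real m)"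
      by (simp add: algebra_simps)
    then show ?thesis by (simp only: e_def)
  qed
  then have "(\<lambda>K. e (- int K - 1)) \<longlonglongrightarrow> 0"
    using lattice_sum_edge [OF c, of i "- real n" "\<lambda>K. - int K - 1" "- real n - real m"] assms
    by simp
  moreover have "(\<lambda>K. e (int K)) \<longlonglongrightarrow> 0"
    using lattice_sum_edge [OF c, of i "real n" int "- real m"] assms
    by (simp add: e_def)
  ultimately have "(\<lambda>K. c * (lattice_sum c n i m K + e (- int K - 1) - e (int K))) \<longlonglongrightarrow> c * (z + 0 - 0)"
    by (intro tendsto_intros lim)
  moreover have "lattice_sum c n i (m + n) = (\<lambda>K. c * (lattice_sum c n i m K + e (- int K - 1) - e (int K)))"
  proof
    fix K
    have "c powi k / (real n * of_int k - real (m + n)) ^ i = c * e (k - 1)" for k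
    proof -
      have "c * c powi (k - 1) = c powi k"
        using c power_int_add [of c 1 "k - 1"] by auto
      then show ?thesis by (simp add: e_def algebra_simps)
    qed
    then have "lattice_sum c n i (m + n) K = c * (\<Sum>k\<in>{- int K..int K}. e (k - 1))"
      by (simp add: lattice_sum_def sum_distrib_left)
    also have "(\<Sum>k\<in>{- int K..int K}. e (k - 1)) = (\<Sum>k\<in>{- int K..int K}. e k) + e (- int K - 1) - e (int K)"
      by (rule sum_symmetric_int_shift)
    also have "(\<Sum>k\<in>{- int K..int K}. e k) = lattice_sum c n i m K"
      by (simp add: lattice_sum_def e_def)
    finally show "lattice_sum c n i (m + n) K = c * (lattice_sum c n i m K + e (- int K - 1) - e (int K))" .
  qed
  ultimately show ?thesis by simp
qed

text \<open>The terms at \<open>k\<close> and \<open>- k\<close> cancel exactly for odd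
  \<open>i\<close> and double for even \<open>i\<close>. Thus the exponent 1, at which the one-sided
  series could diverge, never has to be summed.\<close>

lemma lattice_sum_0:
  assumes c: "c \<in> {1, -1}" and "n > 0" "i > 0"
  shows "lattice_sum c n i 0 \<longlonglongrightarrow> (if even i then 2 * c * lerch_phi c i 1 / real n ^ i else 0)"
proof -
  have eq: "lattice_sum c n i 0 K = (1 + (- 1) ^ i) / real n ^ i * (\<Sum>k=1..K. c ^ k / real k ^ i)" for K
  proof -
    have "c powi k / (real n * of_int k) ^ i + c powi (- k) / (real n * of_int (- k)) ^ i =
        (1 + (- 1) ^ i) / real n ^ i * (c powi k / of_int k ^ i)" for k :: int
      unfolding power_int_sign_minus [OF c]
      using power_minus [of "real n * of_int k" i]
      by (cases "even i") (auto simp: power_mult_distrib)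
    from this [of "int _"] show ?thesis
      using assms by (simp add: lattice_sum_def sum_symmetric_int sum_distrib_left)
  qed
  show ?thesis
  proof (cases "even i")
    case True
    then have "i \<noteq> 1" by auto
    with assms have "(\<lambda>K. (1 + (- 1) ^ i) / real n ^ i * (\<Sum>k=1..K. c ^ k / real k ^ i))
       \<longlonglongrightarrow> (1 + (- 1) ^ i) / real n ^ i * (c * lerch_phi c i 1)"
      by (intro tendsto_mult tendsto_const polylog_tendsto) auto
    with True show ?thesis by (simp add: eq [abs_def] mult_ac)
  qed (simp add: eq [abs_def])
qed

lemma lattice_sum_residue:
  assumes c: "c \<in> {1, -1}" and s: "0 < s" "s < n" and i: "i > 0"
  shows "lattice_sum c n i s \<longlonglongrightarrow> c * lerch_theta c i (real n - real s) (real n) / real n ^ i"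
proof -
  define \<alpha> where "\<alpha> = (real n - real s) / real n"
  have \<alpha>: "0 < \<alpha>" "\<alpha> < 1" using s by (auto simp: \<alpha>_def field_simps)
  have s_eq: "real s = real n * (1 - \<alpha>)" using s by (simp add: \<alpha>_def field_simps)
  \<comment> \<open>Index \<open>k + 1\<close> is paired with index \<open>- k\<close>: the linear
    form is \<open>n * (k + \<alpha>)\<close> at the former and
    \<open>- n * (k + 1 - \<alpha>)\<close> at the latter. The window from \<open>- K\<close> to
    \<open>K\<close> then has one unpaired term, at \<open>- K\<close>, which is an edge term. For
    \<open>c = i = 1\<close> this pairing is the one in the cotangent series.\<close>
  define g where "g k = c ^ k * (c / (real k + \<alpha>) ^ i + (- 1) ^ i / (real k + 1 - \<alpha>) ^ i)" for k
  have eq: "lattice_sum c n i s K = ((\<Sum>k<K. g k) + (- 1) ^ i * (c powi (int K) / (1 * real K + (1 - \<alpha>)) ^ i)) / real n ^ i" for K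
  proof (induction K)
    case 0
    have "1 / (- real s) ^ i = (- 1) ^ i / ((1 - \<alpha>) ^ i * real n ^ i)"
      unfolding s_eq power_minus [of "_ * _"] by (cases "even i") (simp_all add: power_mult_distrib)
    then show ?case by (simp add: lattice_sum_def)
  next
    case (Suc K)
    have "lattice_sum c n i s (Suc K) = lattice_sum c n i s K
        + c ^ Suc K / (real n * real (Suc K) - real s) ^ i + c ^ Suc K / (- (real n * real (Suc K) + real s)) ^ i"
      using power_int_sign_minus [OF c, of "int (Suc K)"]
      by (simp add: lattice_sum_def sum_symmetric_int algebra_simps minus_diff_commute del: of_nat_Suc power_Suc)
    also have "real n * real (Suc K) - real s = real n * (real K + \<alpha>)"
      by (simp add: s_eq algebra_simps)
    also have "real n * real (Suc K) + real s = real n * (real (Suc K) + (1 - \<alpha>))"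
      by (simp add: s_eq algebra_simps)
    also have "c ^ Suc K / (- (real n * (real (Suc K) + (1 - \<alpha>)))) ^ i =
        (- 1) ^ i * (c ^ Suc K / (real (Suc K) + (1 - \<alpha>)) ^ i) / real n ^ i"
      unfolding power_minus [of "_ * _"] by (cases "even i") (simp_all add: power_mult_distrib)
    also have "c ^ Suc K / (real n * (real K + \<alpha>)) ^ i = c ^ K * (c / (real K + \<alpha>) ^ i) / real n ^ i"
      by (simp add: power_mult_distrib mult_ac)
    finally show ?case
      unfolding Suc by (simp add: g_def algebra_simps add_divide_distrib del: of_nat_Suc)
  qed
  have "g sums (c * lerch_theta c i (real n - real s) (real n))"
  proof (cases "c = 1 \<and> i = 1")
    case True
    then show ?thesis
      using cot_partial_fractions [OF \<alpha>] by (simp add: g_def [abs_def] lerch_theta_def \<alpha>_def)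
  next
    case False
    have "(\<lambda>k. c * (c ^ k / (real k + \<alpha>) ^ i) + (- 1) ^ i * (c ^ k / (real k + (1 - \<alpha>)) ^ i)) sums
       (c * lerch_phi c i \<alpha> + (- 1) ^ i * lerch_phi c i (1 - \<alpha>))"
      using False \<alpha> c i by (intro sums_add sums_mult lerch_phi_sums) auto
    moreover have "c * (c ^ k / (real k + \<alpha>) ^ i) + (- 1) ^ i * (c ^ k / (real k + (1 - \<alpha>)) ^ i) = g k" for k
      by (simp add: g_def algebra_simps)
    moreover have "c * lerch_phi c i \<alpha> + (- 1) ^ i * lerch_phi c i (1 - \<alpha>) = c * lerch_theta c i (real n - real s) (real n)"
    proof -
      have "1 - \<alpha> = (real n - (real n - real s)) / real n"
        using s by (simp add: \<alpha>_def field_simps)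
      then have "lerch_theta c i (real n - real s) (real n) = lerch_phi c i \<alpha> + c * (- 1) ^ i * lerch_phi c i (1 - \<alpha>)"
        unfolding lerch_theta_def using False by (simp only: \<alpha>_def if_False)
      then show ?thesis using c by auto
    qed
    ultimately show ?thesis by simp
  qed
  then have "(\<lambda>K. ((\<Sum>k<K. g k) + (- 1) ^ i * (c powi (int K) / (1 * real K + (1 - \<alpha>)) ^ i)) / real n ^ i)
    \<longlonglongrightarrow> (c * lerch_theta c i (real n - real s) (real n) + (- 1) ^ i * 0) / real n ^ i"
    unfolding sums_def using s by (intro tendsto_intros lattice_sum_edge c i) auto
  then show ?thesis by (simp only: eq [abs_def, symmetric]) simp
qed

text \<open>The limit for the residue \<open>s\<close> modulo \<open>n\<close>, represented in \<open>{1..n}\<close>.\<close>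
definition lattice_limit :: "real \<Rightarrow> nat \<Rightarrow> nat \<Rightarrow> nat \<Rightarrow> real" where
  "lattice_limit c n i s =
     (if s = n then if even i then 2 * lerch_phi c i 1 / real n ^ i else 0
      else c * lerch_theta c i (real n - real s) (real n) / real n ^ i)"

lemma lattice_sum_tendsto:
  assumes c: "c \<in> {1, -1}" and s: "1 \<le> s" "s \<le> n" and i: "i > 0"
  shows "lattice_sum c n i (n * h + s) \<longlonglongrightarrow> c ^ h * lattice_limit c n i s"
proof (induction h)
  case 0
  show ?case
  proof (cases "s = n")
    case True
    \<comment> \<open>The residue \<open>n\<close> is one period away from 0, and the factor
      \<open>c\<close> gained by the shift cancels the one present at 0, since
      \<open>c * c = 1\<close>.\<close>
    have "c * (if even i then 2 * c * lerch_phi c i 1 / real n ^ i else 0) = c ^ 0 * lattice_limit c n i s"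
      using c True by (auto simp: lattice_limit_def)
    then show ?thesis
      using lattice_sum_add [OF c _ i lattice_sum_0 [OF c _ i], of n] True s
      by (simp only:) simp
  next
    case False
    then show ?thesis
      using lattice_sum_residue [OF c _ _ i, of s n] s by (simp add: lattice_limit_def)
  qed
next
  case (Suc h)
  from lattice_sum_add [OF c _ i Suc] s show ?case by (simp add: algebra_simps)
qed

text \<open>A discrete antiderivative over the integers of \<open>b powi y / y ^ p\<close>, so that sums over intervals
  become differences of bounded quantities.\<close>
definition power_prefix :: "real \<Rightarrow> nat \<Rightarrow> int \<Rightarrow> real" where
  "power_prefix b p r = (if r > 0 then \<Sum>l=1..nat (r - 1). b ^ l / real l ^ p
     else - ((- 1) ^ p * (\<Sum>l=1..nat (- r). b ^ l / real l ^ p)))"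

lemma power_prefix_step:
  assumes b: "b \<in> {1, -1}" and "p > 0"
  shows "power_prefix b p (r + 1) - power_prefix b p r = b powi r / of_int r ^ p"
proof (cases r "0::int" rule: linorder_cases)
  case less
  define k where "k = nat (- r - 1)"
  have r: "r = - int (Suc k)" using less by (simp add: k_def)
  have k: "nat (int (Suc k) - 1) = k" by simp
  have "power_prefix b p (r + 1) - power_prefix b p r = (- 1) ^ p * (b ^ Suc k / real (Suc k) ^ p)"
    by (simp add: r k power_prefix_def nat_minus_as_int algebra_simps del: of_nat_Suc)
  also have "\<dots> = b powi r / of_int r ^ p"
    unfolding r power_int_sign_minus [OF b] using power_minus [of "real (Suc k)" p]
    by (cases "even p") (simp_all del: of_nat_Suc)
  finally show ?thesis .
next
  case equal
  \<comment> \<open>Both prefix values are empty sums, in agreement with \<open>1 / 0 = 0\<close> at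
    the omitted pole.\<close>
  then show ?thesis using assms by (simp add: power_prefix_def)
next
  case greater
  define k where "k = nat (r - 1)"
  have r: "r = int (Suc k)" using greater by (simp add: k_def)
  have k: "nat (int (Suc k) - 1) = k" by simp
  show ?thesis by (simp add: r power_prefix_def k del: of_nat_Suc power_Suc)
qed

lemma power_prefix_diff:
  assumes "b \<in> {1, -1}" "p > 0"
  shows "power_prefix b p x - power_prefix b p (x - int M) = (\<Sum>m=1..M. b powi (x - int m) / of_int (x - int m) ^ p)"
proof (induction M)
  case (Suc M)
  then show ?case
    using power_prefix_step [OF assms, of "x - int (Suc M)"] by (simp add: algebra_simps)
qed simp

lemma power_prefix_bounded:
  assumes "b \<in> {1, -1}" "p > 0" "b = 1 \<Longrightarrow> p \<noteq> 1"
  obtains B where "B > 0" "\<And>r. \<bar>power_prefix b p r\<bar> \<le> B"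
proof -
  have "Bseq (\<lambda>K. \<Sum>k=1..K. b ^ k / real k ^ p)"
    using polylog_tendsto [OF assms] by (intro convergent_imp_Bseq convergentI)
  then obtain B where B: "B > 0" "\<And>K. \<bar>\<Sum>k=1..K. b ^ k / real k ^ p\<bar> \<le> B"
    by (auto simp: Bseq_def)
  have "\<bar>power_prefix b p r\<bar> \<le> B" for r
    using B(2) by (auto simp: power_prefix_def abs_mult)
  with B(1) show ?thesis by (rule that)
qed

lemma power_prefix_at_bot:
  assumes "b \<in> {1, -1}" "p > 0" "b = 1 \<Longrightarrow> p \<noteq> 1"
  shows "(\<lambda>M. power_prefix b p (x - int M)) \<longlonglongrightarrow> - ((- 1) ^ p * (b * lerch_phi b p 1))"
proof -
  have "filterlim (\<lambda>M. nat (int M - x)) sequentially sequentially"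
    unfolding filterlim_at_top
  proof
    fix Z :: nat
    show "\<forall>\<^sub>F M in sequentially. Z \<le> nat (int M - x)"
      using eventually_ge_at_top [of "nat (int Z + x)"] by eventually_elim auto
  qed
  from filterlim_compose [OF polylog_tendsto [OF assms] this]
  have "(\<lambda>M. - ((- 1) ^ p * (\<Sum>k=1..nat (int M - x). b ^ k / real k ^ p)))
      \<longlonglongrightarrow> - ((- 1) ^ p * (b * lerch_phi b p 1))"
    by (intro tendsto_intros)
  moreover have "\<forall>\<^sub>F M in sequentially. - ((- 1) ^ p * (\<Sum>k=1..nat (int M - x). b ^ k / real k ^ p))
      = power_prefix b p (x - int M)"
    using eventually_ge_at_top [of "nat x"] by eventually_elim (auto simp: power_prefix_def)
  ultimately show ?thesis by (rule Lim_transform_eventually)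
qed

subsection \<open>Exchanging the order of summation\<close>

text \<open>Moore-Osgood argument: the uniform Cauchy bound passes to the limit in either variable,
  so \<open>U K\<close> stays close to \<open>U K0\<close> and \<open>T M\<close> close to
  \<open>S K0 M\<close>; letting \<open>M\<close> grow puts \<open>L\<close> close to
  \<open>U K0\<close>. Convergence of \<open>U\<close> is a conclusion, and this is how convergence
  of the harmonic series itself is obtained.\<close>

lemma iterated_limits_eq:
  fixes S :: "nat \<Rightarrow> nat \<Rightarrow> real"
  assumes U: "\<And>K. S K \<longlonglongrightarrow> U K" and T: "\<And>M. (\<lambda>K. S K M) \<longlonglongrightarrow> T M"
    and cauchy: "\<And>e. e > 0 \<Longrightarrow> \<exists>K0. \<forall>K\<ge>K0. \<forall>M. \<bar>S K M - S K0 M\<bar> \<le> e"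
    and L: "T \<longlonglongrightarrow> L"
  shows "U \<longlonglongrightarrow> L"
proof (rule LIMSEQ_I)
  fix e :: real assume "e > 0"
  then obtain K0 where K0: "\<And>K M. K \<ge> K0 \<Longrightarrow> \<bar>S K M - S K0 M\<bar> \<le> e / 5"
    using cauchy [of "e / 5"] by auto
  have SU: "\<bar>U K - U K0\<bar> \<le> e / 5" if "K \<ge> K0" for K
    using K0 that by (intro tendsto_upperbound [OF tendsto_rabs [OF tendsto_diff [OF U U]]]) auto
  have ST: "\<bar>T M - S K0 M\<bar> \<le> e / 5" for M
  proof (rule tendsto_upperbound [OF tendsto_rabs [OF tendsto_diff [OF T tendsto_const]]])
    show "\<forall>\<^sub>F K in sequentially. \<bar>S K M - S K0 M\<bar> \<le> e / 5"
      using eventually_ge_at_top [of K0] by eventually_elim (rule K0)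
  qed simp
  have "\<bar>L - U K0\<bar> \<le> e / 5"
    using ST by (intro tendsto_upperbound [OF tendsto_rabs [OF tendsto_diff [OF L U]]]) auto
  then have "norm (U K - L) < e" if "K \<ge> K0" for K
    using SU [OF that] \<open>e > 0\<close> by (simp add: abs_if split: if_splits)
  then show "\<exists>K0. \<forall>K\<ge>K0. norm (U K - L) < e" by blast
qed

text \<open>Summation by parts. The increments of \<open>D\<close> dominate the variation of
  \<open>W\<close> and telescope, so the variation from \<open>J\<close> to \<open>K\<close> costs
  at most \<open>D K - D J\<close>.\<close>

lemma abs_sum_Abel_le:
  fixes u W D :: "nat \<Rightarrow> real"
  assumes u: "\<And>j. \<bar>\<Sum>k=Suc J..j. u k\<bar> \<le> e"
    and W: "\<And>k. \<bar>W k\<bar> \<le> C"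
    and D: "\<And>k. \<bar>W (Suc k) - W k\<bar> \<le> D (Suc k) - D k"
    and "J \<le> K"
  shows "\<bar>\<Sum>k=Suc J..K. u k * W k\<bar> \<le> e * (C + (D K - D J))"
proof -
  define V where "V j = (\<Sum>k=Suc J..j. u k)" for j
  have V: "\<bar>V j\<bar> \<le> e" for j using u by (simp add: V_def)
  \<comment> \<open>With the boundary term subtracted, passing from \<open>K\<close> to
    \<open>Suc K\<close> adds only \<open>- V K * (W (Suc K) - W K)\<close>, and the induction
    closes.\<close>
  have "\<bar>(\<Sum>k=Suc J..K. u k * W k) - V K * W K\<bar> \<le> e * (D K - D J)"
    using \<open>J \<le> K\<close>
  proof (induction K rule: dec_induct)
    case base
    show ?case by (simp add: V_def)
  next
    case (step K)
    have "(\<Sum>k=Suc J..Suc K. u k * W k) - V (Suc K) * W (Suc K) =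
        ((\<Sum>k=Suc J..K. u k * W k) - V K * W K) - V K * (W (Suc K) - W K)"
      using step by (simp add: V_def algebra_simps)
    moreover have "\<bar>V K * (W (Suc K) - W K)\<bar> \<le> e * (D (Suc K) - D K)"
      unfolding abs_mult using V [of K] D [of K] by (intro mult_mono) auto
    ultimately show ?case
      using step.IH by (simp add: algebra_simps abs_le_iff)
  qed
  moreover have "\<bar>V K * W K\<bar> \<le> e * C"
    unfolding abs_mult using V [of K] W [of K] by (intro mult_mono) auto
  ultimately show ?thesis unfolding distrib_left by linarith
qed

lemma summable_polylog:
  fixes c :: real
  assumes "c \<in> {1, -1}" "r > 0" "c = 1 \<Longrightarrow> r \<noteq> 1"
  shows "summable (\<lambda>k. c ^ k / real k ^ r)"
proof -
  have "summable (\<lambda>k. c * (c ^ k / (real k + 1) ^ r))"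
    using assms by (intro summable_mult summable_lerch) auto
  then have "summable (\<lambda>k. c ^ Suc k / real (Suc k) ^ r)"
    by (simp add: add.commute)
  then show ?thesis by (subst (asm) summable_Suc_iff)
qed

text \<open>For even \<open>p\<close> every step of \<open>power_prefix 1 p\<close> is nonnegative,
  also at negative arguments, and equals the absolute step of \<open>power_prefix b p\<close>. So
  the prefix for \<open>b = 1\<close> is a variation function for the one for
  \<open>b\<close>.\<close>

lemma power_prefix_variation:
  assumes b: "b \<in> {1, -1}" and p: "p > 0" "even p" and "x \<le> y"
  shows "\<bar>power_prefix b p y - power_prefix b p x\<bar> \<le> power_prefix 1 p y - power_prefix 1 p x"
  using \<open>x \<le> y\<close>
proof (induction y rule: int_ge_induct)
  case (step y)
  have "\<bar>power_prefix b p (y + 1) - power_prefix b p y\<bar> = power_prefix 1 p (y + 1) - power_prefix 1 p y"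
    using p by (simp add: power_prefix_step [OF b] power_prefix_step abs_power_int_sign [OF b] zero_le_even_power)
  with step.IH show ?case by linarith
qed simp

text \<open>The sign \<open>\<sigma>\<close> selects the half \<open>k > 0\<close> or
  \<open>k < 0\<close> of the lattice. Uniformity in \<open>M\<close> comes from the fact that the
  bracket is a difference of two values of one bounded function, whatever \<open>M\<close>
  is.\<close>

lemma power_prefix_sum_uniform_tail:
  fixes \<sigma> :: int
  assumes a: "a \<in> {1, -1}" "a = 1 \<Longrightarrow> q \<noteq> 1" and b: "b \<in> {1, -1}" "b = 1 \<Longrightarrow> p \<noteq> 1"
    and pq: "p > 0" "q > 0" "odd (p + q)" and \<sigma>: "\<sigma> \<in> {1, -1}" and "e > 0"
  obtains N where "\<And>J K M. N \<le> J \<Longrightarrow> J \<le> K \<Longrightarrow>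
    \<bar>\<Sum>k=Suc J..K. a ^ k / real k ^ q *
      (power_prefix b p (\<sigma> * int (n * k)) - power_prefix b p (\<sigma> * int (n * k) - int M))\<bar> \<le> e"
proof -
  define W where "W M k = power_prefix b p (\<sigma> * int (n * k)) - power_prefix b p (\<sigma> * int (n * k) - int M)"
    for M k
  obtain B where B: "B > 0" "\<And>r. \<bar>power_prefix b p r\<bar> \<le> B"
    using power_prefix_bounded [OF b(1) pq(1) b(2)] by blast
  have W: "\<bar>W M k\<bar> \<le> 2 * B" for M k
    unfolding W_def using B(2) [of "\<sigma> * int (n * k)"] B(2) [of "\<sigma> * int (n * k) - int M"] by linarith
  have "\<exists>N. \<forall>J K M. N \<le> J \<longrightarrow> J \<le> K \<longrightarrow> \<bar>\<Sum>k=Suc J..K. a ^ k / real k ^ q * W M k\<bar> \<le> e"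
  \<comment> \<open>For \<open>q = 1\<close> the sum over \<open>k\<close> converges only conditionally, but then \<open>p\<close> is even, so
    \<open>power_prefix b p\<close> has bounded variation and summation by parts applies.\<close>
  proof (cases "q = 1")
    case False
    \<comment> \<open>Here \<open>q\<close> is at least 2, so the sign \<open>a\<close> can be
      replaced by 1 and absolute convergence suffices.\<close>
    have "summable (\<lambda>k. 1 ^ k / real k ^ q)"
      using False pq by (intro summable_polylog) auto
    then obtain N where N: "\<And>J K. J \<ge> N \<Longrightarrow> norm (\<Sum>k=J..K. 1 ^ k / real k ^ q) < e / (2 * B)"
      using summable_partial_sum_bound [of "\<lambda>k. 1 ^ k / real k ^ q" "e / (2 * B)"] \<open>e > 0\<close> B(1)
      by (metis divide_pos_pos mult_pos_pos zero_less_numeral)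
    have "\<bar>\<Sum>k=Suc J..K. a ^ k / real k ^ q * W M k\<bar> \<le> e" if "N \<le> J" for J K M
    proof -
      have "\<bar>\<Sum>k=Suc J..K. a ^ k / real k ^ q * W M k\<bar> \<le> (\<Sum>k=Suc J..K. 1 ^ k / real k ^ q * (2 * B))"
      proof (rule order_trans [OF sum_abs sum_mono])
        fix k
        have "\<bar>a ^ k\<bar> = 1" using a by (auto simp: power_abs)
        then show "\<bar>a ^ k / real k ^ q * W M k\<bar> \<le> 1 ^ k / real k ^ q * (2 * B)"
          unfolding abs_mult using W [of M k] by (intro mult_mono) auto
      qed
      also have "\<dots> = (\<Sum>k=Suc J..K. 1 ^ k / real k ^ q) * (2 * B)"
        by (simp add: sum_distrib_right)
      also have "\<dots> \<le> e / (2 * B) * (2 * B)"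
        using N [of "Suc J" K] that B(1) by (intro mult_right_mono) auto
      finally show ?thesis using B(1) by simp
    qed
    then show ?thesis by blast
  next
    case True
    with pq have p: "even p" by simp
    with pq have "p \<noteq> 1" by auto
    then obtain B' where B': "B' > 0" "\<And>r. \<bar>power_prefix 1 p r\<bar> \<le> B'"
      using power_prefix_bounded [of 1 p] pq by auto
    \<comment> \<open>\<open>W\<close> is a difference of two prefix values, so its variation is at
      most the sum of two variations; hence the plus sign. For \<open>\<sigma> = - 1\<close> the
      arguments move left as \<open>k\<close> grows, and the factor \<open>\<sigma>\<close> keeps
      \<open>D\<close> increasing.\<close>
    define D where "D M k = of_int \<sigma> * (power_prefix 1 p (\<sigma> * int (n * k)) + power_prefix 1 p (\<sigma> * int (n * k) - int M))"
      for M k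
    have D: "\<bar>D M k\<bar> \<le> 2 * B'" for M k
      unfolding D_def using B'(2) [of "\<sigma> * int (n * k)"] B'(2) [of "\<sigma> * int (n * k) - int M"] \<sigma> by auto
    have var: "\<bar>W M (Suc k) - W M k\<bar> \<le> D M (Suc k) - D M k" for M k
    proof -
      note le = power_prefix_variation [OF b(1) pq(1) p]
      from \<sigma> show ?thesis
      proof (elim insertE emptyE)
        assume "\<sigma> = 1"
        have "int (n * k) \<le> int (n * Suc k)" "int (n * k) - int M \<le> int (n * Suc k) - int M" by simp_all
        from this [THEN le] show ?thesis
          unfolding W_def D_def \<open>\<sigma> = 1\<close> of_int_1 mult_1 by linarith
      next
        assume "\<sigma> = - 1"
        have "- int (n * Suc k) \<le> - int (n * k)" "- int (n * Suc k) - int M \<le> - int (n * k) - int M" by simp_all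
        from this [THEN le] show ?thesis
          unfolding W_def D_def \<open>\<sigma> = - 1\<close> of_int_minus of_int_1 mult_minus1 by linarith
      qed
    qed
    \<comment> \<open>\<open>2 * B\<close> bounds \<open>W\<close>, and \<open>4 * B'\<close> bounds
      \<open>D M K - D M J\<close>.\<close>
    define C where "C = 2 * B + 4 * B'"
    have C: "C > 0" using B(1) B'(1) by (simp add: C_def)
    obtain N where N: "\<And>J K. J \<ge> N \<Longrightarrow> norm (\<Sum>k=J..K. a ^ k / real k ^ q) < e / C"
      using summable_partial_sum_bound [OF summable_polylog [OF a(1) pq(2) a(2)], of "e / C"] \<open>e > 0\<close> C
      by (metis divide_pos_pos)
    have "\<bar>\<Sum>k=Suc J..K. a ^ k / real k ^ q * W M k\<bar> \<le> e" if "N \<le> J" "J \<le> K" for J K M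
    proof -
      have "\<bar>\<Sum>k=Suc J..K. a ^ k / real k ^ q * W M k\<bar> \<le> e / C * (2 * B + (D M K - D M J))"
        using N [of "Suc J"] \<open>N \<le> J\<close> by (intro abs_sum_Abel_le W var \<open>J \<le> K\<close>) (auto intro: less_imp_le)
      also have "\<dots> \<le> e / C * C"
        using D [of M K] D [of M J] \<open>e > 0\<close> C by (intro mult_left_mono) (auto simp: C_def)
      finally show ?thesis using C by simp
    qed
    then show ?thesis by blast
  qed
  then show ?thesis using that unfolding W_def by blast
qed

section \<open>The truncated double sum and its uniform Cauchy property\<close>

definition lattice_double_sum :: "real \<Rightarrow> real \<Rightarrow> nat \<Rightarrow> nat \<Rightarrow> nat \<Rightarrow> nat \<Rightarrow> nat \<Rightarrow> real" where
  "lattice_double_sum a b n p q K M = (\<Sum>k\<in>{- int K..int K}. \<Sum>m=1..M.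
     (a * b ^ n) powi k * b ^ m / ((real n * of_int k) ^ q * (real n * of_int k - real m) ^ p))"

text \<open>Since \<open>b\<close> is its own inverse, the sign of a term is
  \<open>a powi k * b powi (n * k - m)\<close>. The sum over \<open>m\<close> thus runs over an
  interval of values \<open>y = n * k - m\<close> and becomes a prefix difference; the factor
  \<open>(- 1) ^ q\<close> comes from \<open>(n * k) ^ q\<close> at negative
  \<open>k\<close>.\<close>

lemma lattice_double_sum_eq:
  assumes a: "a \<in> {1, -1}" and b: "b \<in> {1, -1}" and "p > 0" "q > 0"
  shows "lattice_double_sum a b n p q K M =
    (\<Sum>k=1..K. a ^ k / (real n * real k) ^ q *
       (power_prefix b p (int (n * k)) - power_prefix b p (int (n * k) - int M)))
    + (- 1) ^ q * (\<Sum>k=1..K. a ^ k / (real n * real k) ^ q *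
       (power_prefix b p (- int (n * k)) - power_prefix b p (- int (n * k) - int M)))"
proof -
  define t where "t k = a powi k / (real n * of_int k) ^ q *
       (power_prefix b p (int n * k) - power_prefix b p (int n * k - int M))" for k
  have "(\<Sum>m=1..M. (a * b ^ n) powi k * b ^ m / ((real n * of_int k) ^ q * (real n * of_int k - real m) ^ p)) = t k" for k
  proof -
    have "(a * b ^ n) powi k * b ^ m = a powi k * b powi (int n * k - int m)" for m
    proof -
      have "b powi (int n * k - int m) = b powi (int n * k) * b powi (- int m)"
        using b power_int_add [of b "int n * k" "- int m"] by auto
      then show ?thesis
        by (simp add: power_int_sign_minus [OF b] power_int_mult_distrib power_int_mult)
    qed
    then show ?thesis
      by (simp add: t_def power_prefix_diff [OF b \<open>p > 0\<close>] sum_distrib_left)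
  qed
  then have "lattice_double_sum a b n p q K M = t 0 + (\<Sum>k=1..K. t (int k) + t (- int k))"
    by (simp add: lattice_double_sum_def sum_symmetric_int)
  moreover have "t 0 = 0" using \<open>q > 0\<close> by (simp add: t_def)
  moreover have "t (- int k) = (- 1) ^ q * (a ^ k / (real n * real k) ^ q *
       (power_prefix b p (- int (n * k)) - power_prefix b p (- int (n * k) - int M)))" for k
    using power_int_sign_minus [OF a, of "int k"] power_minus [of "real n * real k" q]
    by (cases "even q") (simp_all add: t_def)
  moreover have "t (int k) = a ^ k / (real n * real k) ^ q *
       (power_prefix b p (int (n * k)) - power_prefix b p (int (n * k) - int M))" for k
    by (simp add: t_def)
  ultimately show ?thesis
    by (simp only: sum.distrib sum_distrib_left add_0)
qed

lemma lattice_double_sum_uniform_Cauchy: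
  assumes a: "a \<in> {1, -1}" "a = 1 \<Longrightarrow> q \<noteq> 1" and b: "b \<in> {1, -1}" "b = 1 \<Longrightarrow> p \<noteq> 1"
    and pq: "p > 0" "q > 0" "odd (p + q)" and "n > 0" and "e > 0"
  shows "\<exists>J. \<forall>K\<ge>J. \<forall>M. \<bar>lattice_double_sum a b n p q K M - lattice_double_sum a b n p q J M\<bar> \<le> e"
proof -
  define f where "f \<sigma> M k = a ^ k / real k ^ q *
      (power_prefix b p (\<sigma> * int (n * k)) - power_prefix b p (\<sigma> * int (n * k) - int M))" for \<sigma> M k
  have "e * real n ^ q / 2 > 0" using \<open>e > 0\<close> \<open>n > 0\<close> by simp
  note tail = power_prefix_sum_uniform_tail [OF a b pq _ this, where n = n, folded f_def]
  obtain N1 where N1: "\<And>J K M. N1 \<le> J \<Longrightarrow> J \<le> K \<Longrightarrow> \<bar>\<Sum>k=Suc J..K. f 1 M k\<bar> \<le> e * real n ^ q / 2"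
    using tail [of 1] by auto
  obtain N2 where N2: "\<And>J K M. N2 \<le> J \<Longrightarrow> J \<le> K \<Longrightarrow> \<bar>\<Sum>k=Suc J..K. f (- 1) M k\<bar> \<le> e * real n ^ q / 2"
    using tail [of "- 1"] by auto
  define J where "J = max N1 N2"
  have eq: "lattice_double_sum a b n p q K M = ((\<Sum>k=1..K. f 1 M k) + (- 1) ^ q * (\<Sum>k=1..K. f (- 1) M k)) / real n ^ q" for K M
    unfolding lattice_double_sum_eq [OF a(1) b(1) pq(1,2)] f_def
    by (simp add: power_mult_distrib add_divide_distrib sum_divide_distrib sum_distrib_left mult_ac)
  have "\<bar>lattice_double_sum a b n p q K M - lattice_double_sum a b n p q J M\<bar> \<le> e" if "J \<le> K" for K M
  proof -
    have split: "(\<Sum>k=1..K. g k) = (\<Sum>k=1..J. g k) + (\<Sum>k=Suc J..K. g k)" for g :: "nat \<Rightarrow> real"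
      using sum.ub_add_nat [of 1 J g "K - J"] that by simp
    have "(x + x' + s * (y + y')) / d - (x + s * y) / d = (x' + s * y') / d" for x x' y y' s d :: real
      by (simp add: diff_divide_distrib [symmetric] algebra_simps)
    then have "lattice_double_sum a b n p q K M - lattice_double_sum a b n p q J M =
        ((\<Sum>k=Suc J..K. f 1 M k) + (- 1) ^ q * (\<Sum>k=Suc J..K. f (- 1) M k)) / real n ^ q"
      unfolding eq [of K] eq [of J] split [of "f 1 M"] split [of "f (- 1) M"] .
    moreover have "\<bar>(\<Sum>k=Suc J..K. f 1 M k) + (- 1) ^ q * (\<Sum>k=Suc J..K. f (- 1) M k)\<bar> \<le> e * real n ^ q"
    proof -
      have "\<bar>x + (- 1) ^ q * y\<bar> \<le> \<bar>x\<bar> + \<bar>y\<bar>" for x y :: real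
        by (cases "even q") auto
      from this [of "\<Sum>k=Suc J..K. f 1 M k" "\<Sum>k=Suc J..K. f (- 1) M k"]
      show ?thesis using N1 [of J K M] N2 [of J K M] that unfolding J_def by linarith
    qed
    ultimately show ?thesis
      using \<open>n > 0\<close> by (simp add: abs_divide pos_divide_le_eq)
  qed
  then show ?thesis by blast
qed

subsection \<open>The two iterated limits\<close>

lemma gen_harmonic_eq: "b * gen_harmonic p N b = (\<Sum>l=1..N. b ^ l / real l ^ p)"
  unfolding gen_harmonic_def sum_distrib_left
  by (intro sum.cong) (auto simp: power_eq_if)

text \<open>Write \<open>N = n * k\<close> and let \<open>G\<close> be the full partial sum up to
  \<open>N\<close>. The half \<open>k > 0\<close> contributes \<open>G\<close> without its last
  term, because \<open>m\<close> starts at 1, plus a limit constant; by parity the half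
  \<open>k < 0\<close> contributes a second \<open>G\<close> and another constant. The missing last
  term yields the series of exponent \<open>p + q\<close>, the constants the product of two Lerch
  values.\<close>

lemma lattice_double_sum_inner_tendsto:
  assumes a: "a \<in> {1, -1}" and b: "b \<in> {1, -1}" "b = 1 \<Longrightarrow> p \<noteq> 1"
    and pq: "p > 0" "q > 0" "odd (p + q)" and n: "n > 0"
  shows "lattice_double_sum a b n p q K \<longlonglongrightarrow>
    (2 * b * (\<Sum>k<K. a ^ Suc k * gen_harmonic p (n * Suc k) b / real (Suc k) ^ q)
      - (\<Sum>k=1..K. (a * b ^ n) ^ k / real k ^ (p + q)) / real n ^ p
      - (1 - (- 1) ^ p) * (b * lerch_phi b p 1) * (\<Sum>k=1..K. a ^ k / real k ^ q)) / real n ^ q"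
proof -
  define L where "L = b * lerch_phi b p 1"
  define s :: real where "s = (- 1) ^ p"
  have s: "s * s = 1" "(- 1) ^ q = - s"
    using pq by (cases "even p"; simp add: s_def)+
  have eq: "a ^ k / (real n * real k) ^ q * (power_prefix b p (int (n * k)) - - (s * L))
      - s * (a ^ k / (real n * real k) ^ q * (power_prefix b p (- int (n * k)) - - (s * L)))
    = (2 * b * (a ^ k * gen_harmonic p (n * k) b / real k ^ q)
        - (a * b ^ n) ^ k / real k ^ (p + q) / real n ^ p - (1 - s) * L * (a ^ k / real k ^ q)) / real n ^ q"
    if k: "k \<in> {1..K}" for k
  proof -
    define N where "N = n * k"
    have N: "N > 0" using n k by (simp add: N_def)
    define G where "G = (\<Sum>l=1..N. b ^ l / real l ^ p)"
    have "nat (int N - 1) = N - 1" by simp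
    then have "power_prefix b p (int N) = (\<Sum>l=1..N - 1. b ^ l / real l ^ p)"
      using N by (simp add: power_prefix_def)
    moreover have "G = (\<Sum>l=1..N - 1. b ^ l / real l ^ p) + b ^ N / real N ^ p"
      unfolding G_def using N by (cases N) auto
    ultimately have E1: "power_prefix b p (int N) = G - b ^ N / real N ^ p" by simp
    have E2: "power_prefix b p (- int N) = - (s * G)"
      by (simp add: power_prefix_def s_def G_def)
    have g: "b * gen_harmonic p N b = G" by (simp add: gen_harmonic_eq G_def)
    have "power_prefix b p (int N) - - (s * L) - s * (power_prefix b p (- int N) - - (s * L))
      = (G + (s * s) * G) - b ^ N / real N ^ p + s * L - (s * s) * L"
      unfolding E1 E2 by (simp add: algebra_simps)
    also have "\<dots> = 2 * G - b ^ N / real N ^ p - (1 - s) * L" unfolding s by (simp add: algebra_simps)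
    finally have E: "power_prefix b p (int N) - - (s * L) - s * (power_prefix b p (- int N) - - (s * L))
        = 2 * (b * gen_harmonic p N b) - b ^ N / real N ^ p - (1 - s) * L"
      by (simp only: g)
    have rN: "real N ^ r = real n ^ r * real k ^ r" for r by (simp add: N_def power_mult_distrib)
    have cN: "(a * b ^ n) ^ k = a ^ k * b ^ N"
      by (simp add: N_def power_mult_distrib power_mult)
    have "a ^ k / real N ^ q * (power_prefix b p (int N) - - (s * L))
        - s * (a ^ k / real N ^ q * (power_prefix b p (- int N) - - (s * L)))
      = a ^ k / real N ^ q * (power_prefix b p (int N) - - (s * L) - s * (power_prefix b p (- int N) - - (s * L)))"
      by (simp add: algebra_simps)
    also have "\<dots> = a ^ k / real N ^ q * (2 * (b * gen_harmonic p N b) - b ^ N / real N ^ p - (1 - s) * L)"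
      by (simp only: E)
    also have "\<dots> = (2 * b * (a ^ k * gen_harmonic p N b / real k ^ q)
        - (a * b ^ n) ^ k / real k ^ (p + q) / real n ^ p - (1 - s) * L * (a ^ k / real k ^ q)) / real n ^ q"
      unfolding cN rN power_add by (simp add: algebra_simps diff_divide_distrib add_divide_distrib)
    finally show ?thesis by (simp only: N_def of_nat_mult)
  qed
  have "lattice_double_sum a b n p q K \<longlonglongrightarrow>
      (\<Sum>k=1..K. a ^ k / (real n * real k) ^ q * (power_prefix b p (int (n * k)) - - (s * L)))
    + (- 1) ^ q * (\<Sum>k=1..K. a ^ k / (real n * real k) ^ q * (power_prefix b p (- int (n * k)) - - (s * L)))"
    unfolding lattice_double_sum_eq [OF a b(1) pq(1,2), abs_def] s_def L_def
    by (intro tendsto_intros power_prefix_at_bot b pq)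
  also have "(\<Sum>k=1..K. a ^ k / (real n * real k) ^ q * (power_prefix b p (int (n * k)) - - (s * L)))
    + (- 1) ^ q * (\<Sum>k=1..K. a ^ k / (real n * real k) ^ q * (power_prefix b p (- int (n * k)) - - (s * L)))
    = (\<Sum>k=1..K. (2 * b * (a ^ k * gen_harmonic p (n * k) b / real k ^ q)
        - (a * b ^ n) ^ k / real k ^ (p + q) / real n ^ p - (1 - s) * L * (a ^ k / real k ^ q)) / real n ^ q)"
    unfolding s(2) mult_minus_left add_uminus_conv_diff
    unfolding sum_distrib_left
    unfolding sum_subtractf [symmetric]
    by (intro sum.cong refl eq)
  also have "\<dots> = (2 * b * (\<Sum>k=1..K. a ^ k * gen_harmonic p (n * k) b / real k ^ q)
      - (\<Sum>k=1..K. (a * b ^ n) ^ k / real k ^ (p + q)) / real n ^ p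
      - (1 - s) * L * (\<Sum>k=1..K. a ^ k / real k ^ q)) / real n ^ q"
    by (simp only: sum_divide_distrib [symmetric] sum_distrib_left sum_subtractf)
  also have "(\<Sum>k=1..K. a ^ k * gen_harmonic p (n * k) b / real k ^ q) =
      (\<Sum>k<K. a ^ Suc k * gen_harmonic p (n * Suc k) b / real (Suc k) ^ q)"
    by (simp add: sum.atLeast1_atMost_eq del: of_nat_Suc)
  finally show ?thesis by (simp only: s_def L_def)
qed

text \<open>Hockey-stick identity. It gives the total coefficient of the principal part that
  survives at the other pole, where all its terms coincide up to their binomials.\<close>

lemma sum_choose_diagonal:
  assumes "p > 0" "q > 0"
  shows "(\<Sum>l<q. (p - 1 + l) choose (p - 1)) = (p + q - 1) choose p"
proof -
  from assms obtain r t where pq: "p = Suc r" "q = Suc t"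
    by (auto simp: gr0_conv_Suc)
  have "(\<Sum>l\<le>t. (r + l) choose r) = (\<Sum>l\<le>t. (r + l) choose l)"
  proof (rule sum.cong [OF refl])
    show "(r + l) choose r = (r + l) choose l" for l
      using binomial_symmetric [of r "r + l"] by simp
  qed
  also have "\<dots> = Suc (r + t) choose t" by (rule sum_choose_lower)
  also have "\<dots> = Suc (r + t) choose Suc r"
    using binomial_symmetric [of t "Suc (r + t)"] by (simp del: binomial_Suc_Suc)
  finally show ?thesis
    unfolding pq lessThan_Suc_atMost by (simp del: binomial_Suc_Suc sum.atMost_Suc)
qed

text \<open>The last two terms correct for \<open>1 / 0 = 0\<close> on either side.\<close>
lemma partial_fractions_total:
  fixes x y :: real
  assumes pq: "p > 0" "q > 0" and y: "y \<noteq> 0"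
  shows "1 / (x ^ q * (x - y) ^ p) =
      (\<Sum>l<q. (- 1) ^ p * real ((p - 1 + l) choose (p - 1)) / y ^ (p + l) * (1 / x ^ (q - l)))
    + (\<Sum>l<p. (- 1) ^ l * real ((q - 1 + l) choose (q - 1)) / y ^ (q + l) * (1 / (x - y) ^ (p - l)))
    - (- 1) ^ p * real ((p + q - 1) choose p) / y ^ (p + q) * (if x = y then 1 else 0)
    - (- 1) ^ p * real ((p + q - 1) choose q) / y ^ (p + q) * (if x = 0 then 1 else 0)"
proof -
  consider "x = y" | "x = 0" | "x \<noteq> y" "x \<noteq> 0" by blast
  then show ?thesis
  proof cases
    case 1
    \<comment> \<open>At \<open>x = y\<close> the left-hand side and the second sum vanish by
      \<open>1 / 0 = 0\<close>, while all terms of the first sum have the common power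
      \<open>y ^ (p + q)\<close>. Their total is what the third term removes; at
      \<open>x = 0\<close> the roles are exchanged.\<close>
    have "(\<Sum>l<q. (- 1) ^ p * real ((p - 1 + l) choose (p - 1)) / y ^ (p + l) * (1 / x ^ (q - l)))
        = (\<Sum>l<q. (- 1) ^ p / y ^ (p + q) * real ((p - 1 + l) choose (p - 1)))"
      by (intro sum.cong refl) (simp add: 1 power_add [symmetric])
    also have "\<dots> = (- 1) ^ p / y ^ (p + q) * real (\<Sum>l<q. (p - 1 + l) choose (p - 1))"
      by (simp only: sum_distrib_left of_nat_sum)
    also have "\<dots> = (- 1) ^ p * real ((p + q - 1) choose p) / y ^ (p + q)"
      by (simp only: sum_choose_diagonal pq) simp
    finally show ?thesis using 1 pq y by (simp add: power_0_left)
  next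
    case 2
    have "(\<Sum>l<p. (- 1) ^ l * real ((q - 1 + l) choose (q - 1)) / y ^ (q + l) * (1 / (x - y) ^ (p - l)))
        = (\<Sum>l<p. (- 1) ^ p / y ^ (p + q) * real ((q - 1 + l) choose (q - 1)))"
    proof (intro sum.cong refl)
      fix l assume l: "l \<in> {..<p}"
      have "(- 1 :: real) ^ p = (- 1) ^ l * (- 1) ^ (p - l)"
        using l by (simp flip: power_add)
      then have e: "(- 1) ^ l / (x - y) ^ (p - l) = (- 1) ^ p / y ^ (p - l)"
        by (cases "even (p - l)") (simp_all add: 2)
      have "p + q = q + l + (p - l)" using l by simp
      then have y: "y ^ (p + q) = y ^ (q + l) * y ^ (p - l)"
        by (simp only: power_add)
      have "(- 1) ^ l * real ((q - 1 + l) choose (q - 1)) / y ^ (q + l) * (1 / (x - y) ^ (p - l))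
          = real ((q - 1 + l) choose (q - 1)) / y ^ (q + l) * ((- 1) ^ l / (x - y) ^ (p - l))"
        by simp
      also have "\<dots> = (- 1) ^ p / y ^ (p + q) * real ((q - 1 + l) choose (q - 1))"
        unfolding e y by simp
      finally show "(- 1) ^ l * real ((q - 1 + l) choose (q - 1)) / y ^ (q + l) * (1 / (x - y) ^ (p - l))
          = (- 1) ^ p / y ^ (p + q) * real ((q - 1 + l) choose (q - 1))" .
    qed
    also have "\<dots> = (- 1) ^ p / y ^ (p + q) * real (\<Sum>l<p. (q - 1 + l) choose (q - 1))"
      by (simp only: sum_distrib_left of_nat_sum)
    also have "\<dots> = (- 1) ^ p * real ((p + q - 1) choose q) / y ^ (p + q)"
      by (simp only: sum_choose_diagonal pq add.commute [of q p] times_divide_eq_left)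
    finally show ?thesis using 2 pq y by (simp add: power_0_left)
  next
    case 3
    obtain r t where pq': "p = Suc r" "q = Suc t"
      using pq by (metis gr0_implies_Suc)
    have "1 / x * (1 / (x - y)) = 1 / y * (1 / (x - y) - 1 / x)"
      using 3 y by (simp add: field_simps)
    note partial_fraction_expansion [OF this, of t r]
    also have "(1 / x) ^ Suc t * (1 / (x - y)) ^ Suc r = 1 / (x ^ q * (x - y) ^ p)"
      by (simp add: pq' power_one_over)
    also have "(- 1) ^ Suc r * (\<Sum>l\<le>t. real ((r + l) choose r) * (1 / y) ^ (r + l + 1) * (1 / x) ^ (Suc t - l)) =
       (\<Sum>l<q. (- 1) ^ p * real ((p - 1 + l) choose (p - 1)) / y ^ (p + l) * (1 / x ^ (q - l)))"
      unfolding sum_distrib_left pq' lessThan_Suc_atMost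
      by (intro sum.cong refl) (simp add: power_one_over)
    also have "(\<Sum>l\<le>r. (- 1) ^ l * real ((t + l) choose t) * (1 / y) ^ (t + l + 1) * (1 / (x - y)) ^ (Suc r - l)) =
       (\<Sum>l<p. (- 1) ^ l * real ((q - 1 + l) choose (q - 1)) / y ^ (q + l) * (1 / (x - y) ^ (p - l)))"
      unfolding pq' lessThan_Suc_atMost
      by (intro sum.cong refl) (simp add: power_one_over)
    finally show ?thesis using 3 by simp
  qed
qed

text \<open>For fixed \<open>M\<close> only finitely many \<open>m\<close> occur, so the limit in
  \<open>K\<close> is taken term by term after the partial fraction expansion. The limits
  \<open>Z\<close> stay abstract, which separates this step from their evaluation.\<close>

lemma lattice_double_sum_outer_tendsto:
  fixes a b :: real and n p q :: nat
  defines "c \<equiv> a * b ^ n"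
  assumes a: "a \<in> {1, -1}" and b: "b \<in> {1, -1}"
    and pq: "p > 0" "q > 0" and n: "n > 0"
    and Z: "\<And>i m. i > 0 \<Longrightarrow> lattice_sum c n i m \<longlonglongrightarrow> Z i m"
  shows "(\<lambda>K. lattice_double_sum a b n p q K M) \<longlonglongrightarrow>
      (\<Sum>l<q. (- 1) ^ p * real ((p - 1 + l) choose (p - 1)) * Z (q - l) 0 * (\<Sum>m=1..M. b ^ m / real m ^ (p + l)))
    + (\<Sum>l<p. (- 1) ^ l * real ((q - 1 + l) choose (q - 1)) * (\<Sum>m=1..M. b ^ m * Z (p - l) m / real m ^ (q + l)))
    - (- 1) ^ p * real ((p + q - 1) choose p) * (\<Sum>m=1..M. b ^ m * (if n dvd m then c ^ (m div n) else 0) / real m ^ (p + q))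
    - (- 1) ^ p * real ((p + q - 1) choose q) * (\<Sum>m=1..M. b ^ m / real m ^ (p + q))"
proof -
  define \<alpha> :: "nat \<Rightarrow> real" where "\<alpha> l = (- 1) ^ p * real ((p - 1 + l) choose (p - 1))" for l
  define \<beta> :: "nat \<Rightarrow> real" where "\<beta> l = (- 1) ^ l * real ((q - 1 + l) choose (q - 1))" for l
  define \<gamma> :: real where "\<gamma> = (- 1) ^ p * real ((p + q - 1) choose p)"
  define \<delta> :: real where "\<delta> = (- 1) ^ p * real ((p + q - 1) choose q)"
  \<comment> \<open>This collects the corrections at the poles. At most one \<open>k\<close>
    satisfies \<open>n * k = m\<close>, and it lies in the window as soon as \<open>K\<close>
    reaches \<open>m\<close>, so the limit is eventually attained.\<close>
  define D where "D m K = (\<Sum>k\<in>{- int K..int K}. if real n * of_int k = real m then c powi k else 0)" for m K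
  define \<tau> where "\<tau> m = (\<Sum>l<q. \<alpha> l / real m ^ (p + l) * Z (q - l) 0) + (\<Sum>l<p. \<beta> l / real m ^ (q + l) * Z (p - l) m)
       - \<gamma> / real m ^ (p + q) * (if n dvd m then c ^ (m div n) else 0) - \<delta> / real m ^ (p + q)" for m
  have D: "D m \<longlonglongrightarrow> (if n dvd m then c ^ (m div n) else 0)" for m
  proof (rule tendsto_eventually)
    show "\<forall>\<^sub>F K in sequentially. D m K = (if n dvd m then c ^ (m div n) else 0)"
      using eventually_ge_at_top [of m]
    proof eventually_elim
      case (elim K)
      have iff: "real n * of_int k = real m \<longleftrightarrow> n dvd m \<and> k = int (m div n)" for k
      proof -
        have "real n * of_int k = real_of_int (int n * k)" "real m = real_of_int (int m)" by simp_all
        then have "real n * of_int k = real m \<longleftrightarrow> int n * k = int m"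
          by (simp only: of_int_eq_iff)
        also have "\<dots> \<longleftrightarrow> n dvd m \<and> k = int (m div n)"
        proof
          assume *: "int n * k = int m"
          then have "int n dvd int m" by (metis dvd_triv_left)
          moreover have "int m div int n = k" using n by (simp add: * [symmetric])
          ultimately show "n dvd m \<and> k = int (m div n)" by (simp add: zdiv_int)
        next
          assume *: "n dvd m \<and> k = int (m div n)"
          then have "n * (m div n) = m" by simp
          then have "int n * int (m div n) = int m" by (simp only: of_nat_mult [symmetric])
          with * show "int n * k = int m" by simp
        qed
        finally show ?thesis .
      qed
      have "m div n \<le> K" using elim by (meson div_le_dividend le_trans)
      then show ?case unfolding D_def iff by (auto simp: sum.delta)
    qed
  qed
  have single: "(\<Sum>k\<in>{- int K..int K}. c powi k / ((real n * of_int k) ^ q * (real n * of_int k - real m) ^ p)) =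
       (\<Sum>l<q. \<alpha> l / real m ^ (p + l) * lattice_sum c n (q - l) 0 K) + (\<Sum>l<p. \<beta> l / real m ^ (q + l) * lattice_sum c n (p - l) m K)
       - \<gamma> / real m ^ (p + q) * D m K - \<delta> / real m ^ (p + q) * D 0 K" if "m > 0" for m K
  proof -
    have "c powi k / ((real n * of_int k) ^ q * (real n * of_int k - real m) ^ p) =
       (\<Sum>l<q. \<alpha> l / real m ^ (p + l) * (c powi k / (real n * of_int k - real 0) ^ (q - l)))
        + (\<Sum>l<p. \<beta> l / real m ^ (q + l) * (c powi k / (real n * of_int k - real m) ^ (p - l)))
       - \<gamma> / real m ^ (p + q) * (if real n * of_int k = real m then c powi k else 0)
       - \<delta> / real m ^ (p + q) * (if real n * of_int k = real 0 then c powi k else 0)" for k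
    proof -
      have "c powi k / ((real n * of_int k) ^ q * (real n * of_int k - real m) ^ p) =
          c powi k * (1 / ((real n * of_int k) ^ q * (real n * of_int k - real m) ^ p))" by simp
      also have "\<dots> = c powi k * ((\<Sum>l<q. \<alpha> l / real m ^ (p + l) * (1 / (real n * of_int k) ^ (q - l)))
        + (\<Sum>l<p. \<beta> l / real m ^ (q + l) * (1 / (real n * of_int k - real m) ^ (p - l)))
       - \<gamma> / real m ^ (p + q) * (if real n * of_int k = real m then 1 else 0)
       - \<delta> / real m ^ (p + q) * (if real n * of_int k = 0 then 1 else 0))"
        using that partial_fractions_total [OF pq, of "real m" "real n * of_int k"]
        unfolding \<alpha>_def \<beta>_def \<gamma>_def \<delta>_def by simp
      finally show ?thesis
        unfolding distrib_left right_diff_distrib sum_distrib_left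
        by (simp add: mult_ac if_distrib cong: if_cong)
    qed
    then show ?thesis
      unfolding lattice_sum_def D_def sum_distrib_left
      by (simp only: sum.distrib sum_subtractf sum.swap [of _ "{- int K..int K}"])
  qed
  have "lattice_double_sum a b n p q K M = (\<Sum>m=1..M. b ^ m *
      ((\<Sum>l<q. \<alpha> l / real m ^ (p + l) * lattice_sum c n (q - l) 0 K) + (\<Sum>l<p. \<beta> l / real m ^ (q + l) * lattice_sum c n (p - l) m K)
       - \<gamma> / real m ^ (p + q) * D m K - \<delta> / real m ^ (p + q) * D 0 K))" for K
  proof -
    have "lattice_double_sum a b n p q K M = (\<Sum>m=1..M. b ^ m *
      (\<Sum>k\<in>{- int K..int K}. c powi k / ((real n * of_int k) ^ q * (real n * of_int k - real m) ^ p)))"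
      unfolding lattice_double_sum_def c_def sum_distrib_left
      by (subst sum.swap) (simp add: mult_ac)
    also have "\<dots> = (\<Sum>m=1..M. b ^ m *
      ((\<Sum>l<q. \<alpha> l / real m ^ (p + l) * lattice_sum c n (q - l) 0 K) + (\<Sum>l<p. \<beta> l / real m ^ (q + l) * lattice_sum c n (p - l) m K)
       - \<gamma> / real m ^ (p + q) * D m K - \<delta> / real m ^ (p + q) * D 0 K))"
      by (intro sum.cong refl) (subst single; simp)
    finally show ?thesis .
  qed
  moreover have "(\<lambda>K. \<Sum>m=1..M. b ^ m *
      ((\<Sum>l<q. \<alpha> l / real m ^ (p + l) * lattice_sum c n (q - l) 0 K) + (\<Sum>l<p. \<beta> l / real m ^ (q + l) * lattice_sum c n (p - l) m K)
       - \<gamma> / real m ^ (p + q) * D m K - \<delta> / real m ^ (p + q) * D 0 K))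
     \<longlonglongrightarrow> (\<Sum>m=1..M. b ^ m *
      ((\<Sum>l<q. \<alpha> l / real m ^ (p + l) * Z (q - l) 0) + (\<Sum>l<p. \<beta> l / real m ^ (q + l) * Z (p - l) m)
       - \<gamma> / real m ^ (p + q) * (if n dvd m then c ^ (m div n) else 0)
       - \<delta> / real m ^ (p + q) * (if n dvd 0 then c ^ (0 div n) else 0)))"
    by (intro tendsto_sum tendsto_mult tendsto_diff tendsto_add tendsto_const D Z) auto
  moreover have "(\<Sum>m=1..M. b ^ m *
      ((\<Sum>l<q. \<alpha> l / real m ^ (p + l) * Z (q - l) 0) + (\<Sum>l<p. \<beta> l / real m ^ (q + l) * Z (p - l) m)
       - \<gamma> / real m ^ (p + q) * (if n dvd m then c ^ (m div n) else 0)
       - \<delta> / real m ^ (p + q) * (if n dvd 0 then c ^ (0 div n) else 0)))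
    = (\<Sum>l<q. \<alpha> l * Z (q - l) 0 * (\<Sum>m=1..M. b ^ m / real m ^ (p + l)))
    + (\<Sum>l<p. \<beta> l * (\<Sum>m=1..M. b ^ m * Z (p - l) m / real m ^ (q + l)))
    - \<gamma> * (\<Sum>m=1..M. b ^ m * (if n dvd m then c ^ (m div n) else 0) / real m ^ (p + q))
    - \<delta> * (\<Sum>m=1..M. b ^ m / real m ^ (p + q))"
  proof -
    have "b ^ m * ((\<Sum>l<q. \<alpha> l / real m ^ (p + l) * Z (q - l) 0) + (\<Sum>l<p. \<beta> l / real m ^ (q + l) * Z (p - l) m)
       - \<gamma> / real m ^ (p + q) * (if n dvd m then c ^ (m div n) else 0)
       - \<delta> / real m ^ (p + q) * (if n dvd 0 then c ^ (0 div n) else 0))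
     = (\<Sum>l<q. \<alpha> l * Z (q - l) 0 * (b ^ m / real m ^ (p + l)))
     + (\<Sum>l<p. \<beta> l * (b ^ m * Z (p - l) m / real m ^ (q + l)))
     - \<gamma> * (b ^ m * (if n dvd m then c ^ (m div n) else 0) / real m ^ (p + q))
     - \<delta> * (b ^ m / real m ^ (p + q))" for m
      unfolding distrib_left right_diff_distrib sum_distrib_left by (simp add: mult_ac)
    then show ?thesis
      unfolding sum_distrib_left
      by (simp only: sum.distrib sum_subtractf sum.swap [of _ "{1..M}"])
  qed
  ultimately show ?thesis
    unfolding \<alpha>_def \<beta>_def \<gamma>_def \<delta>_def by simp
qed

section \<open>Sums over residue classes modulo \<open>n\<close>\<close>

lemma sum_residue_classes:
  fixes f :: "nat \<Rightarrow> 'a::comm_monoid_add"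
  shows "(\<Sum>m=1..H * n. f m) = (\<Sum>s=1..n. \<Sum>h<H. f (n * h + s))"
proof (induction H)
  case (Suc H)
  have "(\<Sum>m=1..Suc H * n. f m) = (\<Sum>m=1..H * n. f m) + (\<Sum>m=H * n + 1..H * n + n. f m)"
    using sum.ub_add_nat [of 1 "H * n" f n] by (simp add: add.commute)
  also have "(\<Sum>m=H * n + 1..H * n + n. f m) = (\<Sum>s=1..n. f (n * H + s))"
    using sum.shift_bounds_cl_nat_ivl [of f 1 "H * n" n] by (simp add: add.commute mult.commute)
  finally show ?case unfolding Suc by (simp add: sum.distrib)
qed simp

text \<open>The sign \<open>b ^ (n * h)\<close> occurs once in \<open>b ^ m\<close> and once in the
  quasi-period, hence cancels; what remains is \<open>a ^ h\<close>, that is, a Lerch series of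
  \<open>a\<close> at \<open>s / n\<close>.\<close>

lemma residue_class_tendsto:
  fixes a b :: real
  assumes a: "a \<in> {1, -1}" and b: "b \<in> {1, -1}" and r: "r > 0" "a = 1 \<Longrightarrow> r \<noteq> 1" and s: "s > 0" and n: "n > 0"
  shows "(\<lambda>H. \<Sum>h<H. b ^ (n * h + s) * (a * b ^ n) ^ h / real (n * h + s) ^ r)
     \<longlonglongrightarrow> b ^ s * lerch_phi a r (real s / real n) / real n ^ r"
proof -
  have "b ^ (n * h + s) * (a * b ^ n) ^ h / real (n * h + s) ^ r =
      b ^ s / real n ^ r * (a ^ h / (real h + real s / real n) ^ r)" for h
  proof -
    have "b ^ (n * h) * b ^ (n * h) = 1"
      using b by (auto simp: power_add [symmetric] power_mult_distrib [symmetric])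
    then have "b ^ (n * h + s) * (a * b ^ n) ^ h = b ^ s * a ^ h"
      by (simp add: power_add power_mult_distrib power_mult [symmetric])
    moreover have "real (n * h + s) = real n * (real h + real s / real n)"
      using n by (simp add: field_simps)
    ultimately show ?thesis by (simp only: power_mult_distrib) simp
  qed
  moreover have "(\<lambda>H. b ^ s / real n ^ r * (\<Sum>h<H. a ^ h / (real h + real s / real n) ^ r))
     \<longlonglongrightarrow> b ^ s / real n ^ r * lerch_phi a r (real s / real n)"
    using lerch_phi_sums [OF a r, of "real s / real n"] s n
    by (intro tendsto_mult tendsto_const) (simp add: sums_def)
  ultimately show ?thesis by (simp add: sum_distrib_left)
qed

text \<open>Cutting at multiples of \<open>n\<close> gives every residue class the same number of
  terms, so the limit can be taken class by class even for \<open>r = 1\<close>.\<close>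

lemma lattice_block_sum_tendsto:
  fixes a b :: real and n :: nat
  defines "c \<equiv> a * b ^ n"
  assumes a: "a \<in> {1, -1}" and b: "b \<in> {1, -1}" and r: "r > 0" "a = 1 \<Longrightarrow> r \<noteq> 1" and n: "n > 0"
    and Z: "\<And>h s. 1 \<le> s \<Longrightarrow> s \<le> n \<Longrightarrow> Z (n * h + s) = c ^ h * z s"
  shows "(\<lambda>H. \<Sum>m=1..H * n. b ^ m * Z m / real m ^ r)
     \<longlonglongrightarrow> (\<Sum>s=1..n. b ^ s * z s * lerch_phi a r (real s / real n)) / real n ^ r"
proof -
  have "(\<lambda>H. \<Sum>s=1..n. z s * (\<Sum>h<H. b ^ (n * h + s) * c ^ h / real (n * h + s) ^ r))
     \<longlonglongrightarrow> (\<Sum>s=1..n. z s * (b ^ s * lerch_phi a r (real s / real n) / real n ^ r))"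
    unfolding c_def using n by (intro tendsto_sum tendsto_mult tendsto_const residue_class_tendsto a b r) auto
  also have "(\<lambda>H. \<Sum>s=1..n. z s * (\<Sum>h<H. b ^ (n * h + s) * c ^ h / real (n * h + s) ^ r)) =
      (\<lambda>H. \<Sum>m=1..H * n. b ^ m * Z m / real m ^ r)"
    unfolding sum_residue_classes sum_distrib_left
    by (intro ext sum.cong refl) (subst Z; simp)
  finally show ?thesis by (simp add: sum_divide_distrib mult_ac)
qed

subsection \<open>Evaluation\<close>

lemma sum_even_reindex:
  fixes f :: "nat \<Rightarrow> 'a::comm_monoid_add"
  shows "(\<Sum>l<q. if even (q - l) then f (q - l) else 0) = (\<Sum>k=1..q div 2. f (2 * k))"
proof (induction q)
  case (Suc q)
  have "(\<Sum>l<Suc q. if even (Suc q - l) then f (Suc q - l) else 0) =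
      (if even (Suc q) then f (Suc q) else 0) + (\<Sum>k=1..q div 2. f (2 * k))"
    by (simp only: sum.lessThan_Suc_shift diff_Suc_Suc diff_zero Suc)
  also have "\<dots> = (\<Sum>k=1..Suc q div 2. f (2 * k))"
  proof (cases "even (Suc q)")
    case True
    then have "Suc q div 2 = Suc (q div 2)" "2 * Suc (q div 2) = Suc q" by presburger+
    with True show ?thesis by (simp add: add.commute del: mult_Suc_right)
  next
    case False
    then have "Suc q div 2 = q div 2" by presburger
    with False show ?thesis by simp
  qed
  finally show ?case .
qed simp

lemma lerch_phi_0: "c \<in> {1, -1} \<Longrightarrow> lerch_phi c 0 1 = - c / 2"
  by (auto simp: lerch_phi_def)

text \<open>The subtracted pole correction is exactly the term \<open>k = 0\<close> on the right:
  \<open>2 * lerch_phi c 0 1 = - c\<close>, and the two binomials agree by symmetry. With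
  \<open>x\<close> and \<open>F\<close> free, one statement serves both the sum of
  \<open>b\<close>-values and, with \<open>p\<close> and \<open>q\<close> exchanged, the sum of
  \<open>a\<close>-values.\<close>

lemma even_lerch_sum:
  fixes c :: real
  assumes c: "c \<in> {1, -1}" and pq: "p > 0" "q > 0"
  shows "(\<Sum>l<q. real ((p - 1 + l) choose (p - 1)) *
        (if even (q - l) then 2 * lerch_phi c (q - l) 1 / x ^ (q - l) else 0) * F (p + l))
      - c * real ((p + q - 1) choose q) * F (p + q)
    = 2 * (\<Sum>k=0..q div 2. real ((p + q - 2 * k - 1) choose (p - 1)) * x powi (- int (2 * k)) *
        lerch_phi c (2 * k) 1 * F (p + q - 2 * k))"
proof -
  define f where "f i = 2 * (real ((p + q - i - 1) choose (p - 1)) * x powi (- int i) *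
        lerch_phi c i 1 * F (p + q - i))" for i
  have "(\<Sum>l<q. real ((p - 1 + l) choose (p - 1)) *
        (if even (q - l) then 2 * lerch_phi c (q - l) 1 / x ^ (q - l) else 0) * F (p + l)) =
      (\<Sum>l<q. if even (q - l) then f (q - l) else 0)"
  proof (intro sum.cong refl)
    fix l assume "l \<in> {..<q}"
    then have "p + q - (q - l) - 1 = p - 1 + l" "p + q - (q - l) = p + l"
      using pq by auto
    then show "real ((p - 1 + l) choose (p - 1)) *
        (if even (q - l) then 2 * lerch_phi c (q - l) 1 / x ^ (q - l) else 0) * F (p + l) =
      (if even (q - l) then f (q - l) else 0)"
      by (simp only: f_def power_int_minus power_int_of_nat) (simp add: divide_inverse)
  qed
  also have "\<dots> = (\<Sum>k=1..q div 2. f (2 * k))" by (rule sum_even_reindex)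
  finally have sum: "(\<Sum>l<q. real ((p - 1 + l) choose (p - 1)) *
        (if even (q - l) then 2 * lerch_phi c (q - l) 1 / x ^ (q - l) else 0) * F (p + l)) =
      (\<Sum>k=1..q div 2. f (2 * k))" .
  have "(p + q - 1) choose (p - 1) = (p + q - 1) choose q"
    using binomial_symmetric [of q "p + q - 1"] pq by simp
  then have "f 0 = - (c * real ((p + q - 1) choose q) * F (p + q))"
    by (simp add: f_def lerch_phi_0 [OF c])
  moreover have "(\<Sum>k=0..q div 2. f (2 * k)) = f 0 + (\<Sum>k=1..q div 2. f (2 * k))"
    by (simp add: sum.atLeast_Suc_atMost)
  ultimately show ?thesis
    unfolding sum by (simp add: f_def sum_distrib_left)
qed

text \<open>The substitutions are \<open>s = n + 1 - j\<close> and \<open>l = p - k\<close>; the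
  signs agree because even powers of \<open>b\<close> are 1.\<close>

lemma theta_sum_reindex:
  fixes a b :: real and n :: nat
  defines "c \<equiv> a * b ^ n"
  assumes b: "b \<in> {1, -1}" and q: "q > 0" and n: "n > 0"
  shows "(\<Sum>l<p. (- 1) ^ l * real ((q - 1 + l) choose (q - 1)) *
      ((\<Sum>s\<in>{1..<n}. b ^ s * (c * lerch_theta c (p - l) (real n - real s) (real n) / real n ^ (p - l))
          * lerch_phi a (q + l) (real s / real n)) / real n ^ (q + l))) =
    a * b * (- 1) ^ p / real n ^ (p + q) *
    (\<Sum>j=2..n. \<Sum>k=1..p. real ((p + q - k - 1) choose (q - 1)) * b ^ j * (- 1) ^ k
            * lerch_theta c k (real j - 1) (real n)
            * lerch_phi a (p + q - k) ((real n - real j + 1) / real n))"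
proof -
  define g where "g l s = (- 1) ^ l * real ((q - 1 + l) choose (q - 1)) *
      (b ^ s * (c * lerch_theta c (p - l) (real n - real s) (real n) / real n ^ (p - l))
          * lerch_phi a (q + l) (real s / real n) / real n ^ (q + l))" for l s
  have "(\<Sum>l<p. \<Sum>s\<in>{1..<n}. g l s) = (\<Sum>s\<in>{1..<n}. \<Sum>l<p. g l s)"
    by (rule sum.swap)
  also have "\<dots> = (\<Sum>j=2..n. \<Sum>l<p. g l (Suc n - j))"
    by (rule sum.reindex_bij_witness [where i = "\<lambda>j. Suc n - j" and j = "\<lambda>s. Suc n - s"]) auto
  also have "\<dots> = (\<Sum>j=2..n. \<Sum>k=1..p. g (p - k) (Suc n - j))"
    by (rule sum.cong [OF refl], rule sum.reindex_bij_witness [where i = "\<lambda>k. p - k" and j = "\<lambda>l. p - l"]) auto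
  also have "\<dots> = (\<Sum>j=2..n. \<Sum>k=1..p. a * b * (- 1) ^ p / real n ^ (p + q) *
      (real ((p + q - k - 1) choose (q - 1)) * b ^ j * (- 1) ^ k
            * lerch_theta c k (real j - 1) (real n)
            * lerch_phi a (p + q - k) ((real n - real j + 1) / real n)))"
  proof (intro sum.cong refl)
    fix j k assume j: "j \<in> {2..n}" and k: "k \<in> {1..p}"
    have idx: "q - 1 + (p - k) = p + q - k - 1" "p - (p - k) = k" "q + (p - k) = p + q - k"
      using q k by auto
    have re: "real (Suc n - j) = real n - real j + 1" "real n - (real n - real j + 1) = real j - 1"
      using j by auto
    have sgn: "(- 1 :: real) ^ (p - k) = (- 1) ^ p * (- 1) ^ k"
      using k by (auto simp: minus_one_power_iff)
    have pw: "real n ^ (p + q) = real n ^ k * real n ^ (p + q - k)"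
      using k by (simp add: power_add [symmetric])
    have "b ^ (Suc n - j) * b ^ n = b * b ^ j"
    proof -
      have sq: "b ^ m * b ^ m = 1" for m using b by (auto simp: power_mult_distrib [symmetric])
      have "b ^ (Suc n - j) * b ^ j = b ^ Suc n"
        using j by (subst power_add [symmetric]) simp
      moreover have "b ^ (Suc n - j) * b ^ n = (b ^ (Suc n - j) * b ^ j) * (b ^ n * b ^ j)"
        using sq [of j] by (simp add: mult_ac)
      moreover have "b ^ Suc n * (b ^ n * b ^ j) = (b ^ n * b ^ n) * (b * b ^ j)"
        by (simp add: mult_ac)
      ultimately show ?thesis by (simp only: sq mult_1)
    qed
    then have bs: "b ^ (Suc n - j) * c = a * b * b ^ j"
      by (simp add: c_def)
    have "g (p - k) (Suc n - j) = (- 1) ^ p * (- 1) ^ k * real ((p + q - k - 1) choose (q - 1)) *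
       ((b ^ (Suc n - j) * c) * lerch_theta c k (real j - 1) (real n)
         * lerch_phi a (p + q - k) ((real n - real j + 1) / real n) / (real n ^ k * real n ^ (p + q - k)))"
      unfolding g_def idx re sgn by simp
    also have "\<dots> = a * b * (- 1) ^ p / real n ^ (p + q) *
      (real ((p + q - k - 1) choose (q - 1)) * b ^ j * (- 1) ^ k
            * lerch_theta c k (real j - 1) (real n)
            * lerch_phi a (p + q - k) ((real n - real j + 1) / real n))"
      unfolding bs pw by simp
    finally show "g (p - k) (Suc n - j) = a * b * (- 1) ^ p / real n ^ (p + q) *
      (real ((p + q - k - 1) choose (q - 1)) * b ^ j * (- 1) ^ k
            * lerch_theta c k (real j - 1) (real n)
            * lerch_phi a (p + q - k) ((real n - real j + 1) / real n))" .
  qed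
  finally show ?thesis
    by (simp only: g_def sum_distrib_left sum_divide_distrib)
qed

text \<open>The residue \<open>s = n\<close> yields the even-index Lerch values, and the other
  residues yield the \<open>lerch_theta\<close> sum. The correction from the poles
  \<open>m = n * k\<close> fits the former because \<open>b ^ n * c = a\<close>.\<close>

lemma lattice_limit_sum_eq:
  fixes a b :: real and n p q :: nat
  defines "c \<equiv> a * b ^ n"
  assumes a: "a \<in> {1, -1}" and b: "b \<in> {1, -1}" and pq: "p > 0" "q > 0" and n: "n > 0"
  shows "(\<Sum>l<p. (- 1) ^ l * real ((q - 1 + l) choose (q - 1)) *
      ((\<Sum>s=1..n. b ^ s * lattice_limit c n (p - l) s * lerch_phi a (q + l) (real s / real n)) / real n ^ (q + l)))
    - (- 1) ^ p * real ((p + q - 1) choose p) * (a * lerch_phi a (p + q) 1 / real n ^ (p + q)) =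
    (- 1) ^ p * b ^ n * 2 / real n ^ (p + q) *
      (\<Sum>j=0..p div 2. real ((p + q - 2 * j - 1) choose (q - 1))
            * lerch_phi c (2 * j) 1 * lerch_phi a (p + q - 2 * j) 1)
    + a * b * (- 1) ^ p / real n ^ (p + q) *
    (\<Sum>j=2..n. \<Sum>k=1..p. real ((p + q - k - 1) choose (q - 1)) * b ^ j * (- 1) ^ k
            * lerch_theta c k (real j - 1) (real n)
            * lerch_phi a (p + q - k) ((real n - real j + 1) / real n))"
proof -
  have c: "c \<in> {1, -1}" using a b by (cases "even n") (auto simp: c_def)
  have bc: "b ^ n * c = a" using b by (auto simp: c_def power_mult_distrib [symmetric] minus_one_power_iff)
  define F where "F r = lerch_phi a r 1 / real n ^ r" for r
  define u where "u l = (if even (p - l) then 2 * lerch_phi c (p - l) 1 / real n ^ (p - l) else 0)" for l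
  have split: "(\<Sum>s=1..n. b ^ s * lattice_limit c n (p - l) s * lerch_phi a (q + l) (real s / real n)) =
      (\<Sum>s\<in>{1..<n}. b ^ s * (c * lerch_theta c (p - l) (real n - real s) (real n) / real n ^ (p - l))
          * lerch_phi a (q + l) (real s / real n)) + b ^ n * u l * lerch_phi a (q + l) 1" for l
  proof -
    have "{1..n} = insert n {1..<n}" using n by auto
    moreover have "b ^ n * lattice_limit c n (p - l) n * lerch_phi a (q + l) (real n / real n) = b ^ n * u l * lerch_phi a (q + l) 1"
      using n by (simp add: lattice_limit_def u_def)
    moreover have "(\<Sum>s\<in>{1..<n}. b ^ s * lattice_limit c n (p - l) s * lerch_phi a (q + l) (real s / real n)) =
      (\<Sum>s\<in>{1..<n}. b ^ s * (c * lerch_theta c (p - l) (real n - real s) (real n) / real n ^ (p - l))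
          * lerch_phi a (q + l) (real s / real n))"
      by (intro sum.cong refl) (simp add: lattice_limit_def)
    ultimately show ?thesis by simp
  qed
  have summand: "(- 1) ^ l * real ((q - 1 + l) choose (q - 1)) * (b ^ n * u l * lerch_phi a (q + l) 1 / real n ^ (q + l)) =
      (- 1) ^ p * b ^ n * (real ((q - 1 + l) choose (q - 1)) * u l * F (q + l))" if "l < p" for l
    using that by (auto simp: u_def F_def minus_one_power_iff)
  have "(\<Sum>l<p. (- 1) ^ l * real ((q - 1 + l) choose (q - 1)) * (b ^ n * u l * lerch_phi a (q + l) 1 / real n ^ (q + l)))
      - (- 1) ^ p * real ((p + q - 1) choose p) * (a * lerch_phi a (p + q) 1 / real n ^ (p + q))
    = (- 1) ^ p * b ^ n * (\<Sum>l<p. real ((q - 1 + l) choose (q - 1)) * u l * F (q + l))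
      - (- 1) ^ p * real ((p + q - 1) choose p) * ((b ^ n * c) * F (p + q))"
    unfolding sum_distrib_left bc using summand by (auto intro!: sum.cong simp: F_def)
  also have "\<dots> = (- 1) ^ p * b ^ n * ((\<Sum>l<p. real ((q - 1 + l) choose (q - 1)) * u l * F (q + l))
      - c * real ((q + p - 1) choose p) * F (q + p))"
    by (simp add: algebra_simps)
  also have "\<dots> = (- 1) ^ p * b ^ n * (2 * (\<Sum>k=0..p div 2. real ((q + p - 2 * k - 1) choose (q - 1)) *
      real n powi (- int (2 * k)) * lerch_phi c (2 * k) 1 * F (q + p - 2 * k)))"
    unfolding u_def using even_lerch_sum [OF c pq(2,1), of "real n" F] by simp
  also have "(\<Sum>k=0..p div 2. real ((q + p - 2 * k - 1) choose (q - 1)) *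
      real n powi (- int (2 * k)) * lerch_phi c (2 * k) 1 * F (q + p - 2 * k)) =
    (\<Sum>j=0..p div 2. real ((p + q - 2 * j - 1) choose (q - 1))
            * lerch_phi c (2 * j) 1 * lerch_phi a (p + q - 2 * j) 1) / real n ^ (p + q)"
    unfolding sum_divide_distrib
  proof (intro sum.cong refl)
    fix k assume k: "k \<in> {0..p div 2}"
    have "real n ^ (p + q) = real n ^ (2 * k) * real n ^ (p + q - 2 * k)"
      using k by (subst power_add [symmetric]) auto
    moreover have "real n powi (- int (2 * k)) = 1 / real n ^ (2 * k)"
      by (simp only: power_int_minus power_int_of_nat inverse_eq_divide)
    ultimately show "real ((q + p - 2 * k - 1) choose (q - 1)) *
      real n powi (- int (2 * k)) * lerch_phi c (2 * k) 1 * F (q + p - 2 * k) =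
      real ((p + q - 2 * k - 1) choose (q - 1)) * lerch_phi c (2 * k) 1 * lerch_phi a (p + q - 2 * k) 1 / real n ^ (p + q)"
      by (simp only: F_def add.commute [of q p]) simp
  qed
  finally have "(\<Sum>l<p. (- 1) ^ l * real ((q - 1 + l) choose (q - 1)) * (b ^ n * u l * lerch_phi a (q + l) 1 / real n ^ (q + l)))
      - (- 1) ^ p * real ((p + q - 1) choose p) * (a * lerch_phi a (p + q) 1 / real n ^ (p + q))
    = (- 1) ^ p * b ^ n * 2 / real n ^ (p + q) *
      (\<Sum>j=0..p div 2. real ((p + q - 2 * j - 1) choose (q - 1))
            * lerch_phi c (2 * j) 1 * lerch_phi a (p + q - 2 * j) 1)"
    by (simp only: times_divide_eq_right times_divide_eq_left mult.assoc)
  moreover note theta_sum_reindex [OF b pq(2) n, where p = p and a = a, folded c_def]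
  ultimately show ?thesis
    unfolding split add_divide_distrib distrib_left sum.distrib by linarith
qed

theorem theorem5:
  fixes p q n :: nat and a b :: real
  assumes "p > 0" "q > 0" "n > 0"
    and "odd (p + q)"
    and "a \<in> {1, -1}" "b \<in> {1, -1}"
    and "b = 1 \<Longrightarrow> p \<noteq> 1"
    and "a = 1 \<Longrightarrow> q \<noteq> 1"
  shows "(\<lambda>k. a ^ Suc k * gen_harmonic p (n * Suc k) b / real (Suc k) ^ q) sums
    (1 / 2 * a * b ^ (n - 1) * real n powi (- int p) * lerch_phi (a * b ^ n) (p + q) 1
     + 1 / 2 * a * (1 - (- 1) ^ p) * lerch_phi a q 1 * lerch_phi b p 1
     - a * b ^ n * (- real n) ^ q *
         (\<Sum>k=0..q div 2. real ((p + q - 2 * k - 1) choose (p - 1)) * real n powi (- int (2 * k))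
            * lerch_phi (a * b ^ n) (2 * k) 1 * lerch_phi b (p + q - 2 * k) 1)
     + b ^ (n - 1) * (- real n) powi (- int p) *
         (\<Sum>j=0..p div 2. real ((p + q - 2 * j - 1) choose (q - 1))
            * lerch_phi (a * b ^ n) (2 * j) 1 * lerch_phi a (p + q - 2 * j) 1)
     + a / 2 * (- real n) powi (- int p) *
         (\<Sum>j=2..n. \<Sum>k=1..p. real ((p + q - k - 1) choose (q - 1)) * b ^ j * (- 1) ^ k
            * lerch_theta (a * b ^ n) k (real j - 1) (real n)
            * lerch_phi a (p + q - k) ((real n - real j + 1) / real n)))"
proof -
  define c where "c = a * b ^ n"
  note a = \<open>a \<in> {1, -1}\<close> and b = \<open>b \<in> {1, -1}\<close> and p = \<open>p > 0\<close> and q = \<open>q > 0\<close> and n = \<open>n > 0\<close>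
    and odd = \<open>odd (p + q)\<close> and bp = \<open>b = 1 \<Longrightarrow> p \<noteq> 1\<close> and aq = \<open>a = 1 \<Longrightarrow> q \<noteq> 1\<close>
  have c: "c \<in> {1, -1}" using a b by (cases "even n") (auto simp: c_def)
  have bc: "b ^ n * c = a" using b by (auto simp: c_def power_mult_distrib [symmetric] minus_one_power_iff)
  have pq1: "p + q \<noteq> 1" using p q by simp
  define P where "P i = (if even i then 2 * lerch_phi c i 1 / real n ^ i else 0)" for i
  \<comment> \<open>\<open>m = 0\<close> is the residue \<open>n\<close> with
    \<open>h = - 1\<close>, out of reach for a natural number \<open>h\<close>; its factor would be
    the inverse of \<open>c\<close>, which is \<open>c\<close>.\<close>
  define Z where "Z i m = (if m = 0 then c * P i
      else c ^ ((m - 1) div n) * lattice_limit c n i ((m - 1) mod n + 1))" for i m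
  have Z: "lattice_sum c n i m \<longlonglongrightarrow> Z i m" if "i > 0" for i m
  proof (cases "m = 0")
    case True
    have "c * P i = (if even i then 2 * c * lerch_phi c i 1 / real n ^ i else 0)"
      by (simp add: P_def)
    with True show ?thesis
      using lattice_sum_0 [OF c n that] by (simp only: Z_def refl if_True)
  next
    case False
    have "n * ((m - 1) div n) + ((m - 1) mod n + 1) = m" using False by simp
    then show ?thesis
      using lattice_sum_tendsto [OF c _ _ that, of "(m - 1) mod n + 1" n "(m - 1) div n"] False n
      by (simp add: Z_def Suc_le_eq)
  qed
  have Z_block: "Z i (n * h + s) = c ^ h * lattice_limit c n i s" if "1 \<le> s" "s \<le> n" for i h s
  proof -
    obtain t where "s = Suc t" using \<open>1 \<le> s\<close> by (cases s) auto
    with that show ?thesis by (simp add: Z_def)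
  qed
  \<comment> \<open>Cut-offs for \<open>m\<close> are restricted to multiples of \<open>n\<close>,
    so that only complete blocks of residues occur. The limits in \<open>K\<close> and the uniform
    bound are unaffected.\<close>
  define S where "S K H = lattice_double_sum a b n p q K (H * n)" for K H
  define A where "A K = (\<Sum>k<K. a ^ Suc k * gen_harmonic p (n * Suc k) b / real (Suc k) ^ q)" for K
  define C where "C K = (\<Sum>k=1..K. c ^ k / real k ^ (p + q))" for K
  define G where "G K = (\<Sum>k=1..K. a ^ k / real k ^ q)" for K
  define La where "La = a * lerch_phi a q 1"
  define Lb where "Lb = b * lerch_phi b p 1"
  define U where "U K = (2 * b * A K - C K / real n ^ p - (1 - (- 1) ^ p) * Lb * G K) / real n ^ q" for K
  define s3 where "s3 = (\<Sum>k=0..q div 2. real ((p + q - 2 * k - 1) choose (p - 1)) * real n powi (- int (2 * k))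
            * lerch_phi c (2 * k) 1 * lerch_phi b (p + q - 2 * k) 1)"
  define s4 where "s4 = (\<Sum>j=0..p div 2. real ((p + q - 2 * j - 1) choose (q - 1))
            * lerch_phi c (2 * j) 1 * lerch_phi a (p + q - 2 * j) 1)"
  define s5 where "s5 = (\<Sum>j=2..n. \<Sum>k=1..p. real ((p + q - k - 1) choose (q - 1)) * b ^ j * (- 1) ^ k
            * lerch_theta c k (real j - 1) (real n)
            * lerch_phi a (p + q - k) ((real n - real j + 1) / real n))"
  define L where "L = (- 1) ^ p * b * c * 2 * s3 + (- 1) ^ p * b ^ n * 2 / real n ^ (p + q) * s4
      + a * b * (- 1) ^ p / real n ^ (p + q) * s5"
  have "U \<longlonglongrightarrow> L"
  proof (rule iterated_limits_eq)
    show "S K \<longlonglongrightarrow> U K" for K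
      using LIMSEQ_linear [OF lattice_double_sum_inner_tendsto [OF a b bp p q odd n, of K] n]
      by (simp add: S_def [abs_def] U_def A_def C_def G_def Lb_def c_def)
    show "\<exists>J. \<forall>K\<ge>J. \<forall>H. \<bar>S K H - S J H\<bar> \<le> e" if "e > 0" for e
      using lattice_double_sum_uniform_Cauchy [OF a aq b bp p q odd n that] unfolding S_def by blast
    show "(\<lambda>K. S K H) \<longlonglongrightarrow>
      (\<Sum>l<q. (- 1) ^ p * real ((p - 1 + l) choose (p - 1)) * Z (q - l) 0 * (\<Sum>m=1..H * n. b ^ m / real m ^ (p + l)))
    + (\<Sum>l<p. (- 1) ^ l * real ((q - 1 + l) choose (q - 1)) * (\<Sum>m=1..H * n. b ^ m * Z (p - l) m / real m ^ (q + l)))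
    - (- 1) ^ p * real ((p + q - 1) choose p) * (\<Sum>m=1..H * n. b ^ m * (if n dvd m then c ^ (m div n) else 0) / real m ^ (p + q))
    - (- 1) ^ p * real ((p + q - 1) choose q) * (\<Sum>m=1..H * n. b ^ m / real m ^ (p + q))" for H
      unfolding S_def c_def using Z unfolding c_def by (rule lattice_double_sum_outer_tendsto [OF a b p q n])
    have power_sum: "(\<lambda>H. \<Sum>m=1..H * n. b ^ m / real m ^ (p + l)) \<longlonglongrightarrow> b * lerch_phi b (p + l) 1" for l
      using LIMSEQ_linear [OF polylog_tendsto [OF b, of "p + l"] n] p bp by fastforce
    have block_sum: "(\<lambda>H. \<Sum>m=1..H * n. b ^ m * Z (p - l) m / real m ^ (q + l)) \<longlonglongrightarrow>
       (\<Sum>s=1..n. b ^ s * lattice_limit c n (p - l) s * lerch_phi a (q + l) (real s / real n)) / real n ^ (q + l)" for l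
      using q aq Z_block unfolding c_def by (intro lattice_block_sum_tendsto a b n) auto
    have multiple_sum: "(\<lambda>H. \<Sum>m=1..H * n. b ^ m * (if n dvd m then c ^ (m div n) else 0) / real m ^ (p + q))
       \<longlonglongrightarrow> a * lerch_phi a (p + q) 1 / real n ^ (p + q)"
    proof -
      \<comment> \<open>The correction weight is itself periodic up to powers of \<open>c\<close>,
        supported on the residue \<open>s = n\<close>, where
        \<open>(n * h + n) div n = h + 1\<close> accounts for the extra \<open>c\<close>.\<close>
      have "(\<lambda>H. \<Sum>m=1..H * n. b ^ m * (if n dvd m then c ^ (m div n) else 0) / real m ^ (p + q))
       \<longlonglongrightarrow> (\<Sum>s=1..n. b ^ s * (if s = n then c else 0) * lerch_phi a (p + q) (real s / real n)) / real n ^ (p + q)"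
        unfolding c_def
      proof (intro lattice_block_sum_tendsto a b n)
        fix h s :: nat assume s: "1 \<le> s" "s \<le> n"
        show "(if n dvd n * h + s then (a * b ^ n) ^ ((n * h + s) div n) else 0) = (a * b ^ n) ^ h * (if s = n then a * b ^ n else 0)"
        proof (cases "s = n")
          case True
          then have "(n * h + s) div n = Suc h" using n by simp
          with True show ?thesis by simp
        next
          case False
          with s have "\<not> n dvd s" by (auto dest: dvd_imp_le)
          then have "\<not> n dvd n * h + s" by (simp add: dvd_add_right_iff)
          with False show ?thesis by simp
        qed
      qed (use p pq1 in auto)
      also have "(\<Sum>s=1..n. b ^ s * (if s = n then c else 0) * lerch_phi a (p + q) (real s / real n)) =
          (\<Sum>s=1..n. if s = n then b ^ n * c * lerch_phi a (p + q) 1 else 0)"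
        using n by (intro sum.cong refl) auto
      also have "\<dots> = a * lerch_phi a (p + q) 1" using n bc by simp
      finally show ?thesis .
    qed
    have "(\<Sum>l<q. (- 1) ^ p * real ((p - 1 + l) choose (p - 1)) * Z (q - l) 0 * (b * lerch_phi b (p + l) 1))
      - (- 1) ^ p * real ((p + q - 1) choose q) * (b * lerch_phi b (p + q) 1) = (- 1) ^ p * b * c * 2 * s3"
    proof -
      have "(\<Sum>l<q. (- 1) ^ p * real ((p - 1 + l) choose (p - 1)) * Z (q - l) 0 * (b * lerch_phi b (p + l) 1)) =
          (- 1) ^ p * b * c * (\<Sum>l<q. real ((p - 1 + l) choose (p - 1)) * P (q - l) * lerch_phi b (p + l) 1)"
        unfolding sum_distrib_left by (simp add: Z_def mult_ac)
      moreover have "(- 1) ^ p * real ((p + q - 1) choose q) * (b * lerch_phi b (p + q) 1) =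
          (- 1) ^ p * b * c * (c * real ((p + q - 1) choose q) * lerch_phi b (p + q) 1)"
        using c by auto
      moreover have "(\<Sum>l<q. real ((p - 1 + l) choose (p - 1)) * P (q - l) * lerch_phi b (p + l) 1)
          - c * real ((p + q - 1) choose q) * lerch_phi b (p + q) 1 = 2 * s3"
        using even_lerch_sum [OF c p q, of "real n" "\<lambda>r. lerch_phi b r 1"] by (simp only: P_def s3_def)
      ultimately show ?thesis
        by (simp only: right_diff_distrib [symmetric] mult.assoc)
    qed
    then have "L = (\<Sum>l<q. (- 1) ^ p * real ((p - 1 + l) choose (p - 1)) * Z (q - l) 0 * (b * lerch_phi b (p + l) 1))
      + (\<Sum>l<p. (- 1) ^ l * real ((q - 1 + l) choose (q - 1)) *
      ((\<Sum>s=1..n. b ^ s * lattice_limit c n (p - l) s * lerch_phi a (q + l) (real s / real n)) / real n ^ (q + l)))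
      - (- 1) ^ p * real ((p + q - 1) choose p) * (a * lerch_phi a (p + q) 1 / real n ^ (p + q))
      - (- 1) ^ p * real ((p + q - 1) choose q) * (b * lerch_phi b (p + q) 1)"
      using lattice_limit_sum_eq [OF a b p q n, folded c_def, folded s4_def s5_def]
      unfolding L_def by linarith
    then show "(\<lambda>H. 
      (\<Sum>l<q. (- 1) ^ p * real ((p - 1 + l) choose (p - 1)) * Z (q - l) 0 * (\<Sum>m=1..H * n. b ^ m / real m ^ (p + l)))
    + (\<Sum>l<p. (- 1) ^ l * real ((q - 1 + l) choose (q - 1)) * (\<Sum>m=1..H * n. b ^ m * Z (p - l) m / real m ^ (q + l)))
    - (- 1) ^ p * real ((p + q - 1) choose p) * (\<Sum>m=1..H * n. b ^ m * (if n dvd m then c ^ (m div n) else 0) / real m ^ (p + q))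
    - (- 1) ^ p * real ((p + q - 1) choose q) * (\<Sum>m=1..H * n. b ^ m / real m ^ (p + q))) \<longlonglongrightarrow> L"
      by (simp only:) (intro tendsto_intros power_sum block_sum multiple_sum)
  qed
  moreover have "C \<longlonglongrightarrow> c * lerch_phi c (p + q) 1"
    unfolding C_def [abs_def] using p pq1 by (intro polylog_tendsto c) auto
  moreover have "G \<longlonglongrightarrow> La"
    unfolding G_def [abs_def] La_def by (intro polylog_tendsto a q aq)
  \<comment> \<open>\<open>U\<close> is affine in \<open>A\<close> with coefficient
    \<open>2 * b / n ^ q\<close>; solving for \<open>A\<close>, with \<open>b\<close> its own
    inverse, transfers convergence to the harmonic sums.\<close>
  ultimately have "(\<lambda>K. b / 2 * (real n ^ q * U K + C K / real n ^ p + (1 - (- 1) ^ p) * Lb * G K))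
      \<longlonglongrightarrow> b / 2 * (real n ^ q * L + c * lerch_phi c (p + q) 1 / real n ^ p + (1 - (- 1) ^ p) * Lb * La)"
    using n by (intro tendsto_intros) auto
  moreover have "b / 2 * (real n ^ q * U K + C K / real n ^ p + (1 - (- 1) ^ p) * Lb * G K) = A K" for K
    using n b by (auto simp: U_def)
  ultimately have "A \<longlonglongrightarrow> b / 2 * (real n ^ q * L + c * lerch_phi c (p + q) 1 / real n ^ p + (1 - (- 1) ^ p) * Lb * La)"
    by simp
  also have "b / 2 * (real n ^ q * L + c * lerch_phi c (p + q) 1 / real n ^ p + (1 - (- 1) ^ p) * Lb * La) =
     1 / 2 * a * b ^ (n - 1) * real n powi (- int p) * lerch_phi c (p + q) 1
     + 1 / 2 * a * (1 - (- 1) ^ p) * lerch_phi a q 1 * lerch_phi b p 1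
     - a * b ^ n * (- real n) ^ q * s3
     + b ^ (n - 1) * (- real n) powi (- int p) * s4
     + a / 2 * (- real n) powi (- int p) * s5"
  proof -
    have bb: "b * b = 1" using b by auto
    obtain n' where n': "n = Suc n'" using n by (metis gr0_implies_Suc)
    have bn: "b * b ^ n = b ^ (n - 1)" using bb by (simp add: n' mult.assoc [symmetric])
    \<comment> \<open>Parity reconciles the minus sign before \<open>(- n) ^ q\<close> in the claim
      with the sign \<open>(- 1) ^ p\<close> that the computation produces.\<close>
    have sq: "(- 1 :: real) ^ q = - ((- 1) ^ p)" using odd by (auto simp: minus_one_power_iff)
    have nq: "(- real n) ^ q = - ((- 1) ^ p * real n ^ q)"
      using power_minus [of "real n" q] by (simp add: sq)
    have np: "real n powi (- int p) = 1 / real n ^ p"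
      by (simp only: power_int_minus power_int_of_nat inverse_eq_divide)
    have np': "(- real n) powi (- int p) = (- 1) ^ p / real n ^ p"
      by (simp only: power_int_minus power_int_of_nat inverse_eq_divide)
        (cases "even p"; simp)
    have "b * c = a * (b * b ^ n)" by (simp add: c_def)
    then have e1: "b / 2 * (c * lerch_phi c (p + q) 1 / real n ^ p) = 1 / 2 * a * b ^ (n - 1) * (1 / real n ^ p) * lerch_phi c (p + q) 1"
      unfolding bn by simp
    have e2: "b / 2 * ((1 - (- 1) ^ p) * Lb * La) = 1 / 2 * a * (1 - (- 1) ^ p) * lerch_phi a q 1 * lerch_phi b p 1"
      using bb by (simp add: La_def Lb_def mult_ac) 
    have e3: "b / 2 * (real n ^ q * ((- 1) ^ p * b * c * 2 * s3)) = a * b ^ n * ((- 1) ^ p * real n ^ q) * s3"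
      using b by (auto simp: c_def)
    have e4: "b / 2 * (real n ^ q * ((- 1) ^ p * b ^ n * 2 / real n ^ (p + q) * s4)) = b ^ (n - 1) * ((- 1) ^ p / real n ^ p) * s4"
      using n unfolding bn [symmetric] by (simp add: power_add)
    have e5: "b / 2 * (real n ^ q * (a * b * (- 1) ^ p / real n ^ (p + q) * s5)) = a / 2 * ((- 1) ^ p / real n ^ p) * s5"
      using n b by (auto simp: power_add)
    show ?thesis
      unfolding L_def nq np np' distrib_left e1 e2 e3 e4 e5 by simp
  qed
  finally show ?thesis
    unfolding sums_def A_def s3_def s4_def s5_def c_def .
qed

end
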